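(* Let $s$ be a weak composition and let $[T,T+A]$ and $[T',T'+A']$ be two pure intervals of the $s$-weak order with non-empty intersection. Then their intersection is the pure interval $[T'',T''+A'']$ where $T''=T\vee T'$ and $A''$ is the set of couples $(a,c)$ such that $(c,a)$ is a minimal compatible variation of the two intervals, i.e. $(c,a)$ is a compatible variation and there is no $b$ with $a<b<c$ such that $(b,a)$ is a compatible variation.
   Context: A weak composition of length $n$ is a sequence $s=(s(1),\dots,s(n))$ of non-negative integers. An $s$-decreasing tree is a rooted planar tree with $n$ internal nodes labeled bijectively by $1,\dots,n$ (leaves are unlabeled) such that node $i$ has exactly $s(i)+1$ ordered children and labels decrease from root to leaves. For a node $y$ of such a tree $T$ with $s(y)=m$, let $T^y_0,\dots,T^y_m$ be the children of $y$ from left to right, where "child" means the whole subtree; a child is empty if it is just a leaf. $T^y_0$ is the left child, $T^y_m$ the right child, and $T^y_i$ with $0<i<m$ are the middle children. A descendant of $y$ is a node lying in one of the $T^y_i$; it is a middle descendant if it lies in a middle child. Tree-inversions: for nodes $a<c$, $\#_T(c,a)$ is $0$ if $a$ is left of $c$ or belongs to $T^c_0$; it is $i$ if $a$ belongs to $T^c_i$ with $0<i<s(c)$; it is $s(c)$ if $a$ belongs to $T^c_{s(c)}$ or is right of $c$. $\operatorname{inv}(T)$ is the multi-set in which $(c,a)$ occurs $\#_T(c,a)$ times; it determines $T$. The $s$-weak order: $R\preccurlyeq T$ iff $\#_R(c,a)\le \#_T(c,a)$ for all $a<c$. It is known to be a lattice, with join $\vee$ and meet $\wedge$. Intervals are $[T_1,T_2]=\{R: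 T_1\preccurlyeq R\preccurlyeq T_2\}$. Transitive closure: for a multi-set $I$ of pairs $(c,a)$, $a<c$, with multiplicities $\#_I(c,a)$, a transitivity path from $c$ to $a$ is a list $c=b_1>\dots>b_k=a$, $k\ge2$, with $\#_I(b_i,b_{i+1})>0$ for all $i$; $\#_{I^{\mathsf{tc}}}(c,a)$ is the maximal value of $\#_I(b_1,b_2)$ over all such paths (and $0$ if there is none). A pair $(a,c)$ with $a<c$ is a tree-ascent of $T$ if: (i) $a$ is a descendant of $c$; (ii) $a$ does not belong to the right child of $c$; (iii) whenever $c>b>a$ and $a$ is a descendant of $b$, $a$ belongs to the right child of $b$; (iv) if $s(a)>0$, the right child of $a$ is empty. For a (possibly empty) set $A$ of tree-ascents of $T$, $T+A$ is the $s$-decreasing tree whose multi-set of tree-inversions is obtained from $\operatorname{inv}(T)$ by increasing $\#_T(c,a)$ by one for every $(a,c)\in A$ and then taking the transitive closure. A pure interval is an interval of the form $[T,T+A]$ with $A$ a set of tree-ascents of $T$. Variations: $(c,a)$ with $c>a$ varies in $[T_1,T_2]$ if $\#_{T_2}(c,a)>\#_{T_1}(c,a)$; then $(c,a)_v$ with $v=\#_{T_1}(c,a)$ is a variation of $[T_1,T_2]$ (of value $v$). Compatible variations: for two pure intervals $[T,T+A]$, $[T',T'+A']$ with non-empty intersection, $(c,a)_v$ is a compatible variation if $(c,a)_v$ is a variation of both $[T,T+A]$ and $[T',T'+A']$ (with the same value $v$), and for all $b$ with $c>b>a$: if $a$ is a middle descendant of $b$ in $T'$ then $\#_T(b,a)=s(b)$,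 and if $a$ is a middle descendant of $b$ in $T$ then $\#_{T'}(b,a)=s(b)$. One says $(c,a)$ is a compatible variation if $(c,a)_v$ is one for some $v$. *)

theory Defs
  imports "HOL-Algebra.Lattice" "HOL-Library.Multiset"
begin

section \<open>\<open>s\<close>-decreasing trees\<close>

text \<open>
  A weak composition of length \<open>n\<close> is a list \<open>s :: nat list\<close> with \<open>length s = n\<close>. Entries are
  numbered from 1 on paper and from 0 in a list, hence the shift.
\<close>

definition part :: "nat list \<Rightarrow> nat \<Rightarrow> nat" where
  "part s i = s ! (i - 1)"

datatype tree = Leaf | Node nat "tree list"

fun labels :: "tree \<Rightarrow> nat list" where
  "labels Leaf = []"
| "labels (Node y ts) = y # concat (map labels ts)"

fun subtrees :: "tree \<Rightarrow> tree set" where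
  "subtrees Leaf = {Leaf}"
| "subtrees (Node y ts) = insert (Node y ts) (\<Union>t\<in>set ts. subtrees t)"

definition s_trees :: "nat list \<Rightarrow> tree set" where
  "s_trees s = {T. distinct (labels T) \<and> set (labels T) = {1..length s} \<and>
     (\<forall>y ts. Node y ts \<in> subtrees T \<longrightarrow>
        length ts = part s y + 1 \<and> (\<forall>t\<in>set ts. \<forall>x\<in>set (labels t). x < y))}"

text \<open>
  \<open>is_child T y i t\<close>: the \<open>i\<close>-th child of \<open>y\<close> in \<open>T\<close> (a whole subtree, possibly a leaf) is \<open>t\<close>.
  \<open>in_child T y i a\<close>: the node \<open>a\<close> belongs to the \<open>i\<close>-th child of \<open>y\<close>. For \<open>T \<in> s_trees s\<close>, the
  left and right children of \<open>y\<close> are those with index \<open>0\<close> and \<open>part s y\<close>; they coincide if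
  \<open>part s y = 0\<close>.
\<close>

definition is_child :: "tree \<Rightarrow> nat \<Rightarrow> nat \<Rightarrow> tree \<Rightarrow> bool" where
  "is_child T y i t \<longleftrightarrow> (\<exists>ts. Node y ts \<in> subtrees T \<and> i < length ts \<and> ts ! i = t)"

definition in_child :: "tree \<Rightarrow> nat \<Rightarrow> nat \<Rightarrow> nat \<Rightarrow> bool" where
  "in_child T y i a \<longleftrightarrow> (\<exists>t. is_child T y i t \<and> a \<in> set (labels t))"

definition descendant :: "tree \<Rightarrow> nat \<Rightarrow> nat \<Rightarrow> bool" where
  "descendant T y a \<longleftrightarrow> (\<exists>i. in_child T y i a)"

definition middle_descendant :: "nat list \<Rightarrow> tree \<Rightarrow> nat \<Rightarrow> nat \<Rightarrow> bool" where
  "middle_descendant s T y a \<longleftrightarrow> (\<exists>i. 0 < i \<and> i < part s y \<and> in_child T y i a)"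

definition left_of :: "tree \<Rightarrow> nat \<Rightarrow> nat \<Rightarrow> bool" where
  "left_of T a c \<longleftrightarrow> (\<exists>y i j. i < j \<and> in_child T y i a \<and> in_child T y j c)"

section \<open>Tree-inversions and the \<open>s\<close>-weak order\<close>

text \<open>
  Only meaningful for nodes \<open>a < c\<close>; the three branches are then mutually exclusive (for
  \<open>part s c = 0\<close> the first two agree) and cover every case.
\<close>

definition tree_mult :: "nat list \<Rightarrow> tree \<Rightarrow> nat \<Rightarrow> nat \<Rightarrow> nat" where
  "tree_mult s T c a =
     (if left_of T a c \<or> in_child T c 0 a then 0
      else if in_child T c (part s c) a \<or> left_of T c a then part s c
      else (THE i. 0 < i \<and> i < part s c \<and> in_child T c i a))"

definition node_pairs :: "nat list \<Rightarrow> (nat \<times> nat) set" where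
  "node_pairs s = {(c, a). 1 \<le> a \<and> a < c \<and> c \<le> length s}"

definition tree_inv :: "nat list \<Rightarrow> tree \<Rightarrow> (nat \<times> nat) multiset" where
  "tree_inv s T = (\<Sum>(c, a)\<in>node_pairs s. replicate_mset (tree_mult s T c a) (c, a))"

text \<open>The multiplicity of the pair \<open>(c, a)\<close> in the multi-set of tree-inversions of \<open>T\<close>.\<close>

abbreviation card_inv :: "nat list \<Rightarrow> tree \<Rightarrow> nat \<Rightarrow> nat \<Rightarrow> nat" where
  "card_inv s T c a \<equiv> count (tree_inv s T) (c, a)"

definition weak_order :: "nat list \<Rightarrow> tree gorder" where
  "weak_order s =
     \<lparr> carrier = s_trees s, eq = (=),
       le = (\<lambda>R T. \<forall>c a. a < c \<longrightarrow> card_inv s R c a \<le> card_inv s T c a) \<rparr>"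

section \<open>Transitive closure\<close>

definition trans_path :: "(nat \<times> nat) multiset \<Rightarrow> nat \<Rightarrow> nat \<Rightarrow> nat list \<Rightarrow> bool" where
  "trans_path I c a bs \<longleftrightarrow>
     2 \<le> length bs \<and> hd bs = c \<and> last bs = a \<and> sorted_wrt (>) bs \<and>
     (\<forall>i. i + 1 < length bs \<longrightarrow> 0 < count I (bs ! i, bs ! (i + 1)))"

definition tc_mult :: "(nat \<times> nat) multiset \<Rightarrow> nat \<Rightarrow> nat \<Rightarrow> nat" where
  "tc_mult I c a = Max (insert 0 {count I (bs ! 0, bs ! 1) | bs. trans_path I c a bs})"

text \<open>
  A path from \<open>c\<close> to \<open>a\<close> starts with a pair \<open>(c, _)\<close> and ends with a pair \<open>(_, a)\<close> of \<open>I\<close>, so the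
  index set of the sum below is large enough (see \<open>count_tc\<close>).
\<close>

definition tc :: "(nat \<times> nat) multiset \<Rightarrow> (nat \<times> nat) multiset" where
  "tc I = (\<Sum>(c, a)\<in>(fst ` set_mset I) \<times> (snd ` set_mset I). replicate_mset (tc_mult I c a) (c, a))"

section \<open>Tree-ascents and pure intervals\<close>

definition tree_ascents :: "nat list \<Rightarrow> tree \<Rightarrow> (nat \<times> nat) set" where
  "tree_ascents s T = {(a, c). a < c \<and>
     descendant T c a \<and>
     \<not> in_child T c (part s c) a \<and>
     (\<forall>b. a < b \<and> b < c \<and> descendant T b a \<longrightarrow> in_child T b (part s b) a) \<and>
     (0 < part s a \<longrightarrow> is_child T a (part s a) Leaf)}"

text \<open>
  A tree-ascent \<open>(a, c)\<close> contributes the inversion \<open>(c, a)\<close>, hence the converse relation.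
\<close>

definition tree_plus :: "nat list \<Rightarrow> tree \<Rightarrow> (nat \<times> nat) set \<Rightarrow> tree" where
  "tree_plus s T A = (THE U. U \<in> s_trees s \<and> tree_inv s U = tc (tree_inv s T + mset_set (A\<inverse>)))"

text \<open>The interval \<open>[T, T + A]\<close>; it is a pure interval if \<open>T \<in> s_trees s\<close> and \<open>A \<subseteq> tree_ascents s T\<close>.\<close>

definition pure_interval :: "nat list \<Rightarrow> tree \<Rightarrow> (nat \<times> nat) set \<Rightarrow> tree set" where
  "pure_interval s T A = \<lbrace>T..tree_plus s T A\<rbrace>\<^bsub>weak_order s\<^esub>"

section \<open>Variations\<close>

definition variation :: "nat list \<Rightarrow> tree \<Rightarrow> tree \<Rightarrow> nat \<Rightarrow> nat \<Rightarrow> nat \<Rightarrow> bool" where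
  "variation s T\<^sub>1 T\<^sub>2 c a v \<longleftrightarrow>
     a < c \<and> card_inv s T\<^sub>1 c a < card_inv s T\<^sub>2 c a \<and> v = card_inv s T\<^sub>1 c a"

definition compatible_variation_value ::
  "nat list \<Rightarrow> tree \<Rightarrow> (nat \<times> nat) set \<Rightarrow> tree \<Rightarrow> (nat \<times> nat) set \<Rightarrow> nat \<Rightarrow> nat \<Rightarrow> nat \<Rightarrow> bool"
where
  "compatible_variation_value s T A T' A' c a v \<longleftrightarrow>
     variation s T (tree_plus s T A) c a v \<and>
     variation s T' (tree_plus s T' A') c a v \<and>
     (\<forall>b. a < b \<and> b < c \<longrightarrow>
        (middle_descendant s T' b a \<longrightarrow> card_inv s T b a = part s b) \<and>
        (middle_descendant s T b a \<longrightarrow> card_inv s T' b a = part s b))"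

definition compatible_variation ::
  "nat list \<Rightarrow> tree \<Rightarrow> (nat \<times> nat) set \<Rightarrow> tree \<Rightarrow> (nat \<times> nat) set \<Rightarrow> nat \<Rightarrow> nat \<Rightarrow> bool"
where
  "compatible_variation s T A T' A' c a \<longleftrightarrow> (\<exists>v. compatible_variation_value s T A T' A' c a v)"

definition minimal_compatible ::
  "nat list \<Rightarrow> tree \<Rightarrow> (nat \<times> nat) set \<Rightarrow> tree \<Rightarrow> (nat \<times> nat) set \<Rightarrow> (nat \<times> nat) set"
where
  "minimal_compatible s T A T' A' = {(a, c).
     compatible_variation s T A T' A' c a \<and>
     \<not> (\<exists>b. a < b \<and> b < c \<and> compatible_variation s T A T' A' b a)}"

section \<open>Multiplicities\<close>

lemma count_sum_replicate:
  assumes "finite P"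
  shows "count (\<Sum>(x, y)\<in>P. replicate_mset (f x y) (x, y)) (c, a) = (if (c, a) \<in> P then f c a else 0)"
proof -
  have "count (\<Sum>(x, y)\<in>P. replicate_mset (f x y) (x, y)) (c, a)
      = (\<Sum>p\<in>P. if p = (c, a) then f c a else 0)"
    unfolding count_sum by (rule sum.cong) (auto split: prod.splits if_splits)
  also have "\<dots> = (if (c, a) \<in> P then f c a else 0)"
    using assms by simp
  finally show ?thesis .
qed

lemma finite_node_pairs: "finite (node_pairs s)"
  by (rule finite_subset[of _ "{0..length s} \<times> {0..length s}"]) (auto simp: node_pairs_def)

lemma count_inv:
  "count (tree_inv s T) (c, a) = (if (c, a) \<in> node_pairs s then tree_mult s T c a else 0)"
  unfolding tree_inv_def by (rule count_sum_replicate[OF finite_node_pairs])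

lemma count_tc: "count (tc I) (c, a) = tc_mult I c a"
proof (cases "(c, a) \<in> (fst ` set_mset I) \<times> (snd ` set_mset I)")
  case True
  then show ?thesis unfolding tc_def by (subst count_sum_replicate) auto
next
  case False
  have "\<not> trans_path I c a bs" for bs
  proof
    assume "trans_path I c a bs"
    then have len: "2 \<le> length bs" and ends: "hd bs = c" "last bs = a"
      and pos: "\<And>i. i + 1 < length bs \<Longrightarrow> (bs ! i, bs ! (i + 1)) \<in># I"
      by (auto simp: trans_path_def)
    from len have ne: "bs \<noteq> []" by auto
    have "(c, bs ! 1) \<in># I"
      using pos[of 0] len ends ne by (simp add: hd_conv_nth)
    moreover have "(bs ! (length bs - 2), a) \<in># I"
    proof -
      have "length bs - 2 + 1 = length bs - 1" using len by linarith
      then show ?thesis using pos[of "length bs - 2"] len ends ne by (simp add: last_conv_nth)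
    qed
    ultimately have "(c, a) \<in> (fst ` set_mset I) \<times> (snd ` set_mset I)" by force
    with False show False by blast
  qed
  then have "tc_mult I c a = 0" by (simp add: tc_mult_def)
  with False show ?thesis unfolding tc_def by (subst count_sum_replicate) auto
qed

lemma finite_path_values: "finite {count I (bs ! 0, bs ! 1) | bs. trans_path I c a bs}"
proof (rule finite_subset)
  show "{count I (bs ! 0, bs ! 1) | bs. trans_path I c a bs} \<subseteq> count I ` set_mset I"
  proof
    fix x assume "x \<in> {count I (bs ! 0, bs ! 1) | bs. trans_path I c a bs}"
    then obtain bs where x: "x = count I (bs ! 0, bs ! 1)" and p: "trans_path I c a bs" by blast
    have "0 + 1 < length bs" using p by (simp add: trans_path_def)
    then have "0 < count I (bs ! 0, bs ! (0 + 1))" using p unfolding trans_path_def by blast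
    then show "x \<in> count I ` set_mset I" unfolding x by simp
  qed
qed simp

end

theory Submission
  imports Defs
begin

text \<open>
  Write \<open>f\<close> for the function \<open>(c, a) \<mapsto> #T(c, a)\<close> and \<open>h\<close> for that of \<open>T + A\<close>, and
  similarly \<open>f'\<close>, \<open>h'\<close>. Trees correspond to bounded functions that are transitive and planar, and
  \<open>a\<close> is a descendant of \<open>c\<close> iff \<open>f y a = f y c\<close> for all \<open>y > c\<close>. If \<open>(c, a)\<close> varies in \<open>[T, T + A]\<close>,
  then \<open>h c a = f c a + 1\<close>, \<open>a\<close> is a descendant of \<open>c\<close> in \<open>T\<close>, and there is an ascent \<open>(b, c) \<in> A\<close>, the
  root of the variation, such that \<open>b = a\<close>, or \<open>a\<close> lies below \<open>b\<close> outside its right child and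
  \<open>h b a > 0\<close>.

  Once the two intervals meet, we have \<open>max f f' \<le> min h h'\<close>, and a pair on which \<open>f'\<close> is positive and
  \<open>f\<close> vanishes varies in \<open>[T, T + A]\<close>. Hence \<open>max f f'\<close> is already transitive and is the join. The
  inversions of \<open>T'' + A''\<close> are \<open>min h h'\<close>: a pair varying with the same value in both intervals is
  reached by induction on \<open>c - a\<close> through some \<open>b\<close> that witnesses the failure of compatibility or
  of minimality. Minimal compatible pairs are ascents of the join by descent along the roots of
  variations.
\<close>

section \<open>Inversion functions and their ascents\<close>

text \<open>The functions are total on the naturals. Those of a tree vanish off
  \<open>node_pairs s\<close>, so beyond the length of \<open>s\<close> the conditions hold
  trivially.\<close>

definition tree_like :: "(nat \<Rightarrow> nat) \<Rightarrow> (nat \<Rightarrow> nat \<Rightarrow> nat) \<Rightarrow> bool" where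
  "tree_like p f \<longleftrightarrow>
     (\<forall>a c. a < c \<longrightarrow> f c a \<le> p c) \<and>
     (\<forall>a b c. a < b \<longrightarrow> b < c \<longrightarrow> f b a = 0 \<or> f c b \<le> f c a) \<and>
     (\<forall>a b c. a < b \<longrightarrow> b < c \<longrightarrow> f b a = p b \<or> f c a \<le> f c b)"

lemma tree_like_bounded: "tree_like p f \<Longrightarrow> a < c \<Longrightarrow> f c a \<le> p c"
  and tree_like_trans: "tree_like p f \<Longrightarrow> a < b \<Longrightarrow> b < c \<Longrightarrow> 0 < f b a \<Longrightarrow> f c b \<le> f c a"
  and tree_like_planar: "tree_like p f \<Longrightarrow> a < b \<Longrightarrow> b < c \<Longrightarrow> f b a < p b \<Longrightarrow> f c a \<le> f c b"
  unfolding tree_like_def by (blast, metis less_nat_zero_code, metis nat_less_le)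

text \<open>For the inversions \<open>f\<close> of a tree this says that \<open>a\<close> is a descendant of \<open>c\<close>.\<close>

definition below :: "(nat \<Rightarrow> nat \<Rightarrow> nat) \<Rightarrow> nat \<Rightarrow> nat \<Rightarrow> bool" where
  "below f c a \<longleftrightarrow> (\<forall>y>c. f y a = f y c)"

lemma belowD: "below f c a \<Longrightarrow> c < y \<Longrightarrow> f y a = f y c"
  by (simp add: below_def)

lemma tree_like_middle_below:
  assumes "tree_like p f" "a < b" "0 < f b a" "f b a < p b"
  shows "below f b a"
  unfolding below_def
  using tree_like_trans[OF assms(1,2)] tree_like_planar[OF assms(1,2)] assms(3,4)
  by (simp add: order_antisym)

text \<open>For a descendant the multiplicity is the index of its child: \<open>f c a < p c\<close>
  keeps \<open>a\<close> out of the right child of \<open>c\<close>, and the last clause says that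
  the right child of \<open>a\<close> contains no node.\<close>

definition ascents :: "(nat \<Rightarrow> nat) \<Rightarrow> (nat \<Rightarrow> nat \<Rightarrow> nat) \<Rightarrow> (nat \<times> nat) set" where
  "ascents p f = {(a, c). a < c \<and> below f c a \<and> f c a < p c \<and>
     (\<forall>b. a < b \<longrightarrow> b < c \<longrightarrow> below f b a \<longrightarrow> f b a = p b) \<and>
     (0 < p a \<longrightarrow> (\<forall>x<a. f a x = p a \<longrightarrow> \<not> below f a x))}"

text \<open>Otherwise \<open>a\<close> would be a descendant of \<open>b\<close> outside its right
  child, against the third clause of an ascent. The strict inequality leaves room for adding one to
  \<open>f c a\<close> without violating planarity.\<close>

lemma ascents_between:
  assumes f: "tree_like p f" and ac: "(a, c) \<in> ascents p f" and b: "a < b" "b < c"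
  shows "f b a = p b \<or> f c a < f c b"
proof (rule ccontr)
  assume *: "\<not> ?thesis"
  have lt: "f b a < p b"
    using * tree_like_bounded[OF f b(1)] by simp
  \<comment> \<open>Induction from \<open>c\<close> downwards. The truncated difference
    \<open>c - y\<close> vanishes for all \<open>y\<close> from \<open>c\<close> on; there the
    equality follows from planarity and the ascent.\<close>
  have "f y a = f y b" if y: "b < y" for y
    using y
  proof (induction "c - y" arbitrary: y rule: less_induct)
    case less
    have le: "f y a \<le> f y b" using tree_like_planar[OF f b(1) less.prems lt] .
    consider "y = c" | "c < y" | "y < c" by linarith
    then show ?case
    proof cases
      case 1 then show ?thesis using le * by simp
    next
      case 2
      have "f y a = f y c" using ac 2 by (auto simp: ascents_def below_def)
      moreover have "f y b \<le> f y c"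
        using tree_like_planar[OF f b(2) 2] * ac by (fastforce simp: ascents_def)
      ultimately show ?thesis using le by simp
    next
      case 3
      show ?thesis
      proof (rule ccontr)
        assume ne: "f y a \<noteq> f y b"
        then have less_y: "f y a < f y b" using le by simp
        have ay: "a < y" using b less.prems by simp
        have lt_y: "f y a < p y" using less_y tree_like_bounded[OF f less.prems] by linarith
        \<comment> \<open>A strict drop at \<open>y\<close> makes \<open>a\<close> a descendant of
          \<open>y\<close> outside its right child, again against the third clause.\<close>
        have "f z a = f z y" if z: "y < z" for z
        proof (rule order_antisym)
          show "f z a \<le> f z y" using tree_like_planar[OF f ay z lt_y] .
          have "f z y \<le> f z b" using tree_like_trans[OF f less.prems z] less_y by simp
          moreover have "f z a = f z b"
            using less.hyps[of z] z 3 less.prems by simp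
          ultimately show "f z y \<le> f z a" by simp
        qed
        then have "below f y a" by (simp add: below_def)
        then show False using ac 3 ay lt_y by (auto simp: ascents_def)
      qed
    qed
  qed
  then have "below f b a" by (simp add: below_def)
  then show False using ac b * by (auto simp: ascents_def)
qed

section \<open>Variations of a single pure interval\<close>

text \<open>An axiomatic form of \<open>T + A\<close>. In \<open>source\<close>, \<open>b\<close> is
  the second node of a transitivity path that realizes \<open>h c a\<close>, and
  \<open>0 < h b a\<close> stands for the rest of the path. \<open>increment_tc_mult\<close>
  supplies the instance.\<close>

locale increment =
  fixes p :: "nat \<Rightarrow> nat" and f h :: "nat \<Rightarrow> nat \<Rightarrow> nat" and A :: "(nat \<times> nat) set"
  assumes f: "tree_like p f" and h: "tree_like p h" and A: "A \<subseteq> ascents p f"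
    and f_le_h: "a < c \<Longrightarrow> f c a \<le> h c a"
    and step: "(a, c) \<in> A \<Longrightarrow> f c a < h c a"
    and source: "a < c \<Longrightarrow> 0 < h c a \<Longrightarrow>
      \<exists>b. a \<le> b \<and> b < c \<and> h c a = f c b + of_bool ((b, c) \<in> A) \<and> (b = a \<or> 0 < h b a)"
begin

definition varies :: "nat \<Rightarrow> nat \<Rightarrow> bool" where
  "varies c a \<longleftrightarrow> a < c \<and> f c a < h c a"

lemma variesD: "varies c a \<Longrightarrow> a < c" "varies c a \<Longrightarrow> f c a < h c a"
  by (simp_all add: varies_def)

text \<open>An edge of the path is an inversion of \<open>f\<close>, where transitivity applies, or
  an ascent, whose lower end has the same multiplicities as its upper end at every larger
  \<open>y\<close>.\<close>

lemma mono_along_h: "a < b \<Longrightarrow> 0 < h b a \<Longrightarrow> b < y \<Longrightarrow> f y b \<le> f y a"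
proof (induction b rule: less_induct)
  case (less b)
  obtain r where r: "a \<le> r" "r < b" "h b a = f b r + of_bool ((r, b) \<in> A)" "r = a \<or> 0 < h r a"
    using source[OF less.prems(1,2)] by blast
  have "f y b \<le> f y r"
  proof (cases "(r, b) \<in> A")
    case True
    then show ?thesis using A less.prems(3) by (auto simp: ascents_def below_def)
  next
    case False
    then show ?thesis using tree_like_trans[OF f r(2) less.prems(3)] r(3) less.prems(2) by simp
  qed
  also have "f y r \<le> f y a"
  proof (cases "r = a")
    case False
    then show ?thesis using less.IH[of r] r less.prems by simp
  qed simp
  finally show ?case .
qed

text \<open>The first edge of the path leads to some \<open>b\<close> with
  \<open>f c b \<le> f c a < h c a\<close>, so this edge must carry the increment of an
  ascent.\<close>

lemma root_weak:
  assumes "varies c a"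
  obtains b where "(b, c) \<in> A" "a \<le> b" "b < c" "f c b = f c a" "h c a = f c a + 1" "b = a \<or> 0 < h b a"
proof -
  have ac: "a < c" "f c a < h c a" using variesD[OF assms] .
  obtain b where b: "a \<le> b" "b < c" "h c a = f c b + of_bool ((b, c) \<in> A)" "b = a \<or> 0 < h b a"
    using source[OF ac(1)] ac(2) by auto
  have "f c b \<le> f c a" using mono_along_h[of a b c] b by (cases "b = a") auto
  then have "(b, c) \<in> A" "f c b = f c a" using b(3) ac(2) by (auto simp: of_bool_def split: if_splits)
  then show ?thesis using that b by simp
qed

text \<open>The root \<open>b\<close> is below \<open>c\<close>, so
  \<open>f y c = f y b \<le> f y a\<close>. Planarity at \<open>f c a = f c b < p c\<close> gives
  the converse inequality.\<close>

lemma varies_below: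
  assumes "varies c a" shows "below f c a"
  unfolding below_def
proof (intro allI impI)
  fix y assume y: "c < y"
  obtain b where b: "(b, c) \<in> A" "a \<le> b" "b < c" "f c b = f c a" "b = a \<or> 0 < h b a"
    using root_weak[OF assms] by metis
  have eq: "f y b = f y c" using b(1) y A by (auto simp: ascents_def below_def)
  have "f y b \<le> f y a" using mono_along_h[of a b y] b y by (cases "b = a") auto
  moreover have "f y a \<le> f y c"
    using tree_like_planar[OF f variesD(1)[OF assms] y] b(1,4) A by (fastforce simp: ascents_def)
  ultimately show "f y a = f y c" using eq by simp
qed

lemma varies_Suc: "varies c a \<Longrightarrow> h c a = f c a + 1"
  using root_weak by metis

text \<open>For \<open>b < y < c\<close>, \<open>ascents_between\<close> makes \<open>f y b\<close>
  maximal or forces \<open>f y a = 0\<close>; either way \<open>f y b \<le> f y a\<close> is an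
  equality. If \<open>b \<noteq> a\<close>, the empty right child of \<open>b\<close> then gives
  \<open>f b a < p b\<close>.\<close>

lemma root:
  assumes "varies c a"
  obtains b where "(b, c) \<in> A" "a \<le> b" "b < c" "f c b = f c a" "below f b a"
    "b = a \<or> 0 < h b a \<and> 0 < p b \<and> f b a < p b"
proof -
  obtain b where b: "(b, c) \<in> A" "a \<le> b" "b < c" "f c b = f c a" "b = a \<or> 0 < h b a"
    using root_weak[OF assms] by metis
  have asc: "(b, c) \<in> ascents p f" using b A by blast
  have ac: "a < c" using assms variesD by blast
  have bel: "below f b a"
  proof (cases "b = a")
    case False
    show ?thesis
      unfolding below_def
    proof (intro allI impI)
      fix y assume y: "b < y"
      have le: "f y b \<le> f y a" using mono_along_h[of a b y] b y False by auto
      consider "y = c" | "c < y" | "y < c" by linarith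
      then show "f y a = f y b"
      proof cases
        case 2
        then show ?thesis
          using belowD[OF varies_below[OF assms] 2] asc by (auto simp: ascents_def below_def)
      next
        case 3
        have ay: "a < y" using b y by simp
        from ascents_between[OF f asc y 3] show ?thesis
        proof
          assume "f y b = p y"
          then show ?thesis using le tree_like_bounded[OF f ay] by simp
        next
          assume "f c b < f c y"
          then have "f y a = 0" using tree_like_trans[OF f ay 3] b(4) by fastforce
          then show ?thesis using le by simp
        qed
      qed (use b in simp)
    qed
  qed (simp add: below_def)
  have "b = a \<or> 0 < h b a \<and> 0 < p b \<and> f b a < p b"
  proof (cases "b = a")
    case False
    then have "a < b" "0 < h b a" using b by auto
    moreover have "0 < p b" using tree_like_bounded[OF h \<open>a < b\<close>] \<open>0 < h b a\<close> by simp
    moreover have "f b a \<noteq> p b" using asc bel \<open>a < b\<close> \<open>0 < p b\<close> by (auto simp: ascents_def)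
    ultimately show ?thesis using tree_like_bounded[OF f \<open>a < b\<close>] by auto
  qed simp
  then show ?thesis using that b bel by blast
qed

text \<open>A converse to \<open>root\<close>: transitivity of \<open>h\<close> carries the
  increment of the ascent \<open>(r, c)\<close> down to \<open>b\<close>.\<close>

lemma varies_descend:
  assumes "(r, c) \<in> A" "b \<le> r" "b = r \<or> 0 < h r b" "f c b = f c r"
  shows "varies c b"
proof -
  have "r < c" using assms(1) A by (auto simp: ascents_def)
  have "h c r \<le> h c b"
    using assms(2,3) tree_like_trans[OF h _ \<open>r < c\<close>, of b] by (cases "b = r") auto
  then show ?thesis using step[OF assms(1)] assms(2,4) \<open>r < c\<close> by (simp add: varies_def)
qed

text \<open>Two vertices attached to \<open>c\<close> at the same child: the lower one would lie in the right child
  of the upper one, which is empty.\<close>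

lemma root_unique:
  assumes "(r, c) \<in> A" "(r', c) \<in> A" "f c r = f c r'" "0 < p r"
  shows "r \<le> r'"
proof (rule ccontr)
  assume "\<not> r \<le> r'"
  then have lt: "r' < r" by simp
  have asc: "(r, c) \<in> ascents p f" "(r', c) \<in> ascents p f" using assms A by auto
  have "r < c" using asc by (auto simp: ascents_def)
  have "f y r' = f y r" if y: "r < y" for y
  proof -
    have r'y: "r' < y" using y lt by simp
    consider "y = c" | "c < y" | "y < c" by linarith
    then show ?thesis
    proof cases
      case 2
      then show ?thesis using asc by (auto simp: ascents_def below_def)
    next
      case 3
      show ?thesis
      proof (cases "f c r < f c y")
        case True
        then have "f y r = 0" "f y r' = 0"
          using tree_like_trans[OF f y 3] tree_like_trans[OF f r'y 3] assms(3) by fastforce+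
        then show ?thesis by simp
      next
        case False
        then show ?thesis
          using ascents_between[OF f asc(1) y 3] ascents_between[OF f asc(2) r'y 3] assms(3) by simp
      qed
    qed (use assms(3) in simp)
  qed
  then have "below f r r'" by (simp add: below_def)
  moreover have "f r r' = p r"
    using ascents_between[OF f asc(2) lt \<open>r < c\<close>] assms(3) by simp
  ultimately show False using asc(1) lt assms(4) by (auto simp: ascents_def)
qed

text \<open>Let \<open>e\<close> be the root of \<open>(c, a)\<close>. If \<open>e < b\<close>,
  \<open>ascents_between\<close> gives \<open>f b e = p b\<close>, hence \<open>f b a = p b\<close>.
  If \<open>b < e\<close>, positivity of \<open>h e b\<close> comes from
  \<open>f e b = f e a\<close> or, when this is zero, from induction at \<open>e\<close>.\<close>

lemma varies_between:
  assumes "varies c a" "a < b" "b < c" "below f b a" "f b a < p b"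
  shows "varies c b"
  using assms
proof (induction c rule: less_induct)
  case (less c)
  obtain e where e: "(e, c) \<in> A" "a \<le> e" "e < c" "f c e = f c a" "below f e a"
      "e = a \<or> 0 < h e a \<and> 0 < p e \<and> f e a < p e"
    using root[OF less.prems(1)] by blast
  have asc: "(e, c) \<in> ascents p f" using e A by blast
  have cb: "f c b = f c a" using belowD[OF less.prems(4,3)] by simp
  consider "e = b" | "e < b" | "b < e" by linarith
  then show ?case
  proof cases
    case 1 then show ?thesis using varies_descend[OF e(1)] by simp
  next
    case 2
    have "f b e = p b" using ascents_between[OF f asc 2 less.prems(3)] cb e(4) by simp
    then show ?thesis using belowD[OF e(5) 2] less.prems(5) by simp
  next
    case 3
    have ae: "a < e" "0 < h e a" using e(6) 3 less.prems by auto
    have eb: "f e b = f e a" using belowD[OF less.prems(4) 3] by simp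
    have "0 < h e b"
    proof (cases "f e a = 0")
      case True
      then have "varies e a" using ae by (simp add: varies_def)
      then have "varies e b" using less.IH[OF e(3)] 3 less.prems by blast
      then show ?thesis by (auto simp: varies_def)
    next
      case False
      then show ?thesis using f_le_h[OF 3] eb by simp
    qed
    then show ?thesis using varies_descend[OF e(1)] 3 cb e(4) by simp
  qed
qed

text \<open>Both roots are attached to \<open>c\<close> with the same value, so
  \<open>root_unique\<close> applies in both directions, except when the first root is
  \<open>a\<close> itself, which is smaller than \<open>b\<close>.\<close>

lemma common_root:
  assumes "varies c a" "varies c b" "f c a = f c b" "a < b" "0 < p b"
  obtains e where "(e, c) \<in> A" "b \<le> e" "e < c" "f c e = f c a" "below f e a" "below f e b"
    "0 < p e" "0 < h e a" "f e a < p e" "b = e \<or> 0 < h e b \<and> f e b < p e"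
proof -
  obtain e where e: "(e, c) \<in> A" "a \<le> e" "e < c" "f c e = f c a" "below f e a"
      "e = a \<or> 0 < h e a \<and> 0 < p e \<and> f e a < p e"
    using root[OF assms(1)] by blast
  obtain e' where e': "(e', c) \<in> A" "b \<le> e'" "e' < c" "f c e' = f c b" "below f e' b"
      "e' = b \<or> 0 < h e' b \<and> 0 < p e' \<and> f e' b < p e'"
    using root[OF assms(2)] by blast
  have "e = e'"
  proof (rule order_antisym)
    show "e' \<le> e"
      using root_unique[OF e'(1) e(1)] e e' assms(3,5) by auto
    show "e \<le> e'"
    proof (cases "e = a")
      case False
      then show ?thesis using root_unique[OF e(1) e'(1)] e e' assms(3) by simp
    qed (use e' assms(4) in simp)
  qed
  then show ?thesis using that[of e] e e' assms(4) by auto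
qed

text \<open>This contradiction ends \<open>minimal_no_gap\<close>. In each position of
  \<open>e\<close> a positive value is propagated to \<open>h e a\<close>: through \<open>r\<close>
  if \<open>e < c\<close>, through \<open>c\<close> if \<open>c < e\<close>.\<close>

lemma varies_cross:
  assumes "(r, c) \<in> A" "a < b" "b < r" "r < e" "varies c a" "varies c b" "f c r = f c b"
    and "0 < h r a" "h e a = 0" "0 < h e b"
  shows False
proof -
  have r: "(r, c) \<in> ascents p f" "r < c" using assms(1) A by (auto simp: ascents_def)
  have be: "b < e" using assms by simp
  consider "e < c" | "e = c" | "c < e" by linarith
  then show False
  proof cases
    case 1
    have "f c e \<le> f c b" using mono_along_h[OF be assms(10) 1] .
    then have "f e r = p e" using ascents_between[OF f r(1) assms(4) 1] assms(7) by simp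
    moreover have "f e r \<le> h e r" using f_le_h[OF assms(4)] .
    moreover have "h e r \<le> h e a"
      using tree_like_trans[OF h _ assms(4,8)] assms(2,3) by simp
    ultimately show ?thesis
      using assms(9,10) tree_like_bounded[OF h be] by simp
  next
    case 2
    then show ?thesis using assms(5,9) by (simp add: varies_def)
  next
    case 3
    have ac: "a < c" "b < c" using variesD assms(5,6) by auto
    have lt: "f c b < p c" using variesD[OF assms(6)] tree_like_bounded[OF h] by fastforce
    have "0 < h e c"
    proof (cases "f e b = 0")
      case True
      then have "varies e b" using be assms(10) by (simp add: varies_def)
      then show ?thesis
        using varies_between[OF _ ac(2) 3 varies_below[OF assms(6)] lt] by (auto simp: varies_def)
    next
      case False
      then show ?thesis using tree_like_planar[OF f ac(2) 3 lt] f_le_h[OF 3] by simp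
    qed
    moreover have "h e c \<le> h e a"
      using tree_like_trans[OF h ac(1) 3] variesD[OF assms(5)] by simp
    ultimately show ?thesis using assms(9) by simp
  qed
qed

end

section \<open>Two pure intervals that meet\<close>

text \<open>A common element lies above \<open>f\<close> and \<open>f'\<close> and below
  \<open>h\<close> and \<open>h'\<close>, whence the two cross inequalities.\<close>

locale increment_pair = I1: increment p f h A + I2: increment p f' h' A'
  for p f h A f' h' A' +
  assumes f_le_h': "a < c \<Longrightarrow> f c a \<le> h' c a" and f'_le_h: "a < c \<Longrightarrow> f' c a \<le> h c a"
begin

lemma increment_pair_swap: "increment_pair p f' h' A' f h A"
  using I1.increment_axioms I2.increment_axioms f_le_h' f'_le_h
  by (auto simp: increment_pair_def increment_pair_axioms_def)

definition both :: "nat \<Rightarrow> nat \<Rightarrow> bool" where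
  "both c a \<longleftrightarrow> I1.varies c a \<and> I2.varies c a \<and> f c a = f' c a"

text \<open>\<open>0 < f b a < p b\<close> says that \<open>a\<close> is a middle descendant of \<open>b\<close>: it already forces \<open>a\<close> to be a
  descendant of \<open>b\<close>.\<close>

definition free_between :: "nat \<Rightarrow> nat \<Rightarrow> bool" where
  "free_between c a \<longleftrightarrow> (\<forall>b. a < b \<longrightarrow> b < c \<longrightarrow>
     (0 < f' b a \<longrightarrow> f' b a < p b \<longrightarrow> f b a = p b) \<and> (0 < f b a \<longrightarrow> f b a < p b \<longrightarrow> f' b a = p b))"

definition compatible :: "nat \<Rightarrow> nat \<Rightarrow> bool" where
  "compatible c a \<longleftrightarrow> both c a \<and> free_between c a"

definition minimal :: "nat \<Rightarrow> nat \<Rightarrow> bool" where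
  "minimal c a \<longleftrightarrow> compatible c a \<and> (\<forall>b. a < b \<longrightarrow> b < c \<longrightarrow> \<not> compatible b a)"

lemma free_between_mono: "free_between c a \<Longrightarrow> b \<le> c \<Longrightarrow> free_between b a"
  unfolding free_between_def by (meson less_le_trans)

abbreviation fmax :: "nat \<Rightarrow> nat \<Rightarrow> nat" where "fmax c a \<equiv> max (f c a) (f' c a)"

text \<open>If only \<open>f'\<close> is positive at \<open>(b, a)\<close>, then
  \<open>h b a\<close> is positive as well and \<open>mono_along_h\<close> applies. This makes the
  pointwise maximum transitive.\<close>

lemma f_mono_along_fmax: "a < b \<Longrightarrow> 0 < fmax b a \<Longrightarrow> b < c \<Longrightarrow> f c b \<le> f c a"
  using I1.mono_along_h[of a b c] I1.f_le_h[of a b] f'_le_h[of a b] by simp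

text \<open>In \<open>T'\<close>, \<open>a\<close> is a middle descendant of \<open>b\<close>. In
  \<open>T\<close> it is one too, or \<open>f b a = 0 < h b a\<close> and \<open>(b, a)\<close>
  varies. So \<open>a\<close> is below \<open>b\<close> in both, and \<open>varies_between\<close>
  applies twice.\<close>

lemma both_between:
  assumes "both c a" "a < b" "b < c" "0 < f' b a" "f' b a < p b" "f b a < p b"
  shows "both c b"
proof -
  have vars: "I1.varies c a" "I2.varies c a" and eq: "f c a = f' c a"
    using assms(1) by (simp_all add: both_def)
  have bel': "below f' b a" using tree_like_middle_below[OF I2.f] assms by blast
  have "0 < h b a" using f'_le_h[OF assms(2)] assms(4) by simp
  then have bel: "below f b a"
    using I1.varies_below[of b a] tree_like_middle_below[OF I1.f assms(2) _ assms(6)] assms(2)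
    by (cases "f b a = 0") (auto simp: I1.varies_def)
  have "I1.varies c b" "I2.varies c b"
    using I1.varies_between I2.varies_between vars assms bel bel' by blast+
  moreover have "f c b = f' c b"
    using belowD[OF bel assms(3)] belowD[OF bel' assms(3)] eq by simp
  ultimately show ?thesis by (simp add: both_def)
qed

text \<open>Descent in \<open>c\<close>: the common root \<open>e\<close> of \<open>(c, a)\<close>
  and \<open>(c, x)\<close> is larger than \<open>a\<close>, and freeness makes
  \<open>(e, a)\<close> and \<open>(e, x)\<close> vary with equal value again. This serves the last
  clause of an ascent of the join.\<close>

lemma right_child_empty:
  assumes "free_between c a" "I1.varies c a" "I1.varies c x" "f c x = f c a"
    and x: "x < a" "f a x = p a" "0 < p a" "below fmax a x"
  shows False
  using assms(1-4)
proof (induction c rule: less_induct)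
  case (less c)
  obtain e where e: "(e, c) \<in> A" "a \<le> e" "e < c" "0 < h e x" "f e x < p e"
      "a = e \<or> 0 < h e a \<and> f e a < p e"
    using I1.common_root[OF less.prems(3,2,4) x(1,3)] less.prems(4) by blast
  have ae: "a < e" using e x(2) by (cases "a = e") auto
  have xe: "x < e" using ae x(1) by simp
  have ea: "0 < h e a" "f e a < p e" using e(6) ae by auto
  have eq: "fmax e x = fmax e a" using belowD[OF x(4) ae] .
  have bnd: "h e a \<le> p e" "h e x \<le> p e" "f' e a \<le> p e" "f' e a \<le> h e a" "fmax e x \<le> h e x"
    using tree_like_bounded[OF I1.h ae] tree_like_bounded[OF I1.h xe] tree_like_bounded[OF I2.f ae]
      f'_le_h[OF ae] f'_le_h[OF xe] I1.f_le_h[OF xe] by auto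
  have free: "0 < f' e a \<Longrightarrow> f' e a < p e \<Longrightarrow> f e a = p e" "0 < f e a \<Longrightarrow> f' e a = p e"
    using less.prems(1) ae e(3) ea(2) unfolding free_between_def by blast+
  have "I1.varies e a \<and> I1.varies e x \<and> f e x = f e a"
  proof (cases "f e a = 0")
    case True
    then have va: "I1.varies e a" using ea ae by (simp add: I1.varies_def)
    then have one: "h e a = 1" using I1.varies_Suc True by simp
    \<comment> \<open>A positive \<open>f' e a\<close> is squeezed to \<open>p e = 1\<close>, while
      \<open>f e x < p e\<close>.\<close>
    have "f e x = 0"
    proof (cases "f' e a = 0")
      case True
      then show ?thesis using eq \<open>f e a = 0\<close> by simp
    next
      case False
      then show ?thesis using free(1) one bnd(4) ea(2) e(5) True by linarith
    qed
    then show ?thesis using va True e(4) xe by (simp add: I1.varies_def)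
  next
    case False
    then have "f' e a = p e" using free(2) by simp
    \<comment> \<open>Both values of \<open>h\<close> are maximal, so both values of
      \<open>f\<close> are \<open>p e - 1\<close>.\<close>
    then have "h e a = p e" "h e x = p e" using bnd eq by linarith+
    then have "I1.varies e a" "I1.varies e x" using ea(2) e(5) ae xe by (simp_all add: I1.varies_def)
    then show ?thesis
      using I1.varies_Suc \<open>h e a = p e\<close> \<open>h e x = p e\<close> by (metis add_right_cancel)
  qed
  then show False
    using less.IH[OF e(3)] free_between_mono[OF less.prems(1)] e(3) by simp
qed

text \<open>Replaces \<open>c\<close> by the root \<open>e\<close> of the two variations \<open>(c, a)\<close> and \<open>(c, b)\<close>. Either the
  situation is reproduced at \<open>e\<close>, or \<open>a\<close> and \<open>b\<close> are separated there.\<close>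

lemma descend:
  assumes free: "free_between c a" and none: "\<And>x. a < x \<Longrightarrow> x < c \<Longrightarrow> \<not> both x a"
    and var: "I1.varies c a" "I1.varies c b" "f c a = f c b" and b: "a < b" "0 < p b" "h b a = 0"
  obtains e where "b < e" "e < c" "(e, c) \<in> A" "f c e = f c b" "0 < h e a"
    "I1.varies e a \<and> I1.varies e b \<and> f e a = f e b \<or> 0 < f e b \<and> h' e a = 0"
proof -
  obtain e where e: "(e, c) \<in> A" "b \<le> e" "e < c" "f c e = f c a" "0 < h e a" "f e a < p e"
      "b = e \<or> 0 < h e b \<and> f e b < p e"
    using I1.common_root[OF var b(1,2)] by blast
  have be: "b < e" using e b(3) by (cases "b = e") auto
  have eb: "0 < h e b" "f e b < p e" using e(7) be by auto
  have ae: "a < e" using be b(1) by simp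
  have le: "h e a \<le> h e b" using tree_like_planar[OF I1.h b(1) be] b(2,3) by simp
  have bnd: "h e b \<le> p e" "f' e a \<le> p e" "f' e a \<le> h e a"
    using tree_like_bounded[OF I1.h be] tree_like_bounded[OF I2.f ae] f'_le_h[OF ae] .
  have free: "0 < f' e a \<Longrightarrow> f' e a < p e \<Longrightarrow> f e a = p e" "0 < f e a \<Longrightarrow> f' e a = p e"
    using free ae e(3,6) unfolding free_between_def by blast+
  have "I1.varies e a \<and> I1.varies e b \<and> f e a = f e b \<or> 0 < f e b \<and> h' e a = 0"
  proof (cases "f e a = 0")
    case True
    then have va: "I1.varies e a" using e ae by (simp add: I1.varies_def)
    then have one: "h e a = 1" using I1.varies_Suc True by simp
    show ?thesis
    proof (cases "f e b = 0")
      case True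
      then show ?thesis using va eb be \<open>f e a = 0\<close> by (simp add: I1.varies_def)
    next
      case False
      \<comment> \<open>Otherwise freeness would give \<open>f' e a = p e = 1\<close>, leaving no
        room for \<open>0 < f e b < p e\<close>.\<close>
      then have "f' e a = 0" using free(1) one bnd(3) eb(2) e(6) by linarith
      moreover from this have "\<not> I2.varies e a"
        using none[OF ae e(3)] va True by (simp add: both_def)
      ultimately show ?thesis using False ae by (simp add: I2.varies_def)
    qed
  next
    case False
    then have "f' e a = p e" using free(2) by simp
    then have "h e a = p e" "h e b = p e" using bnd le by linarith+
    then have "I1.varies e a" "I1.varies e b" using eb(2) e(6) ae be by (simp_all add: I1.varies_def)
    then show ?thesis
      using I1.varies_Suc \<open>h e a = p e\<close> \<open>h e b = p e\<close> by (metis add_right_cancel)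
  qed
  then show ?thesis using that[of e] be e var(3) by simp
qed

text \<open>The least \<open>c\<close> carrying both variations with equal value excludes the first
  alternative of \<open>descend\<close>, so \<open>a\<close> and \<open>b\<close> are separated at
  the root found there.\<close>

lemma separated:
  assumes "free_between c0 a" "\<And>x. a < x \<Longrightarrow> x < c0 \<Longrightarrow> \<not> both x a"
    and "I1.varies c0 a" "I1.varies c0 b" "f c0 a = f c0 b" "a < b" "0 < p b" "h b a = 0"
  obtains c e where "b < e" "(e, c) \<in> A" "f c e = f c b" "0 < h e a" "0 < f e b" "h' e a = 0"
    "I1.varies c a" "I1.varies c b"
proof -
  define P where "P c \<longleftrightarrow> I1.varies c a \<and> I1.varies c b \<and> f c a = f c b" for c
  define c where "c = (LEAST c. P c)"
  have "P c0" using assms by (simp add: P_def)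
  then have "P c" and le: "c \<le> c0" unfolding c_def by (auto intro: LeastI Least_le)
  then have vars: "I1.varies c a" "I1.varies c b" "f c a = f c b" by (simp_all add: P_def)
  have none: "\<not> both x a" if "a < x" "x < c" for x using assms(2) that le by simp
  have "\<not> P e" if "e < c" for e using not_less_Least that unfolding c_def by blast
  moreover obtain e where "b < e" "e < c" "(e, c) \<in> A" "f c e = f c b" "0 < h e a"
      "P e \<or> 0 < f e b \<and> h' e a = 0"
    using descend[OF free_between_mono[OF assms(1) le] none vars assms(6-8)] unfolding P_def by blast
  ultimately show ?thesis using that \<open>P c\<close> unfolding P_def by blast
qed

end

section \<open>The join and the lower bound for its increments\<close>

text \<open>Planarity passes to a pointwise maximum. Transitivity in general does not, and is
  supplied by the third hypothesis.\<close>

lemma tree_like_max: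
  assumes "tree_like p f" "tree_like p f'"
    and "\<And>a b c. a < b \<Longrightarrow> b < c \<Longrightarrow> 0 < max (f b a) (f' b a) \<Longrightarrow> f c b \<le> f c a \<and> f' c b \<le> f' c a"
  shows "tree_like p (\<lambda>c a. max (f c a) (f' c a))"
  unfolding tree_like_def
proof (intro conjI allI impI)
  fix a c :: nat assume "a < c"
  then show "max (f c a) (f' c a) \<le> p c" using assms(1,2) by (simp add: tree_like_bounded)
next
  fix a b c :: nat assume ab: "a < b" and bc: "b < c"
  then show "max (f b a) (f' b a) = 0 \<or> max (f c b) (f' c b) \<le> max (f c a) (f' c a)"
    using assms(3)[OF ab bc] by (meson bot_nat_0.not_eq_extremum max.mono)
  show "max (f b a) (f' b a) = p b \<or> max (f c a) (f' c a) \<le> max (f c b) (f' c b)"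
    using tree_like_planar[OF assms(1) ab bc] tree_like_planar[OF assms(2) ab bc]
      tree_like_bounded[OF assms(1) ab] tree_like_bounded[OF assms(2) ab] by linarith
qed

context increment_pair
begin

interpretation swap: increment_pair p f' h' A' f h A
  by (rule increment_pair_swap)

lemma tree_like_fmax: "tree_like p fmax"
  using f_mono_along_fmax swap.f_mono_along_fmax
  by (intro tree_like_max I1.f I2.f) (auto simp: max.commute)

lemma both_swap: "swap.both c a \<longleftrightarrow> both c a"
  by (auto simp: both_def swap.both_def)

lemma free_between_swap: "swap.free_between c a \<longleftrightarrow> free_between c a"
  by (auto simp: free_between_def swap.free_between_def)

lemma compatible_swap: "swap.compatible c a \<longleftrightarrow> compatible c a"
  by (simp add: compatible_def swap.compatible_def both_swap free_between_swap)

lemma minimal_swap: "swap.minimal c a \<longleftrightarrow> minimal c a"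
  by (simp add: minimal_def swap.minimal_def compatible_swap)

lemma fmax_both: "both c a \<Longrightarrow> fmax c a = f c a"
  by (simp add: both_def)

lemma below_fmax: "below f c a \<Longrightarrow> below f' c a \<Longrightarrow> below fmax c a"
  by (simp add: below_def)

text \<open>\<open>g\<close> will be the inversions of \<open>T'' + A''\<close>.\<close>

lemma both_increment:
  assumes g_trans: "\<And>a b c. a < b \<Longrightarrow> b < c \<Longrightarrow> 0 < g b a \<Longrightarrow> g c b \<le> g c a"
    and fmax_le: "\<And>a c. a < c \<Longrightarrow> fmax c a \<le> g c a"
    and g_step: "\<And>a c. minimal c a \<Longrightarrow> fmax c a < g c a"
    and "both c a"
  shows "fmax c a < g c a"
  using assms(4)
proof (induction "c - a" arbitrary: c a rule: less_induct)
  case less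
  have ac: "a < c" using less.prems by (simp add: both_def I1.varies_def)
  \<comment> \<open>A pivot \<open>b\<close> for which \<open>(c, b)\<close> is already incremented
    passes the increment on to \<open>(c, a)\<close>.\<close>
  have split: "fmax c a < g c a" if b: "a < b" "b < c" and cb: "both c b" and pos: "0 < g b a"
      and eq: "fmax c a = fmax c b" for b
  proof -
    have "fmax c b < g c b" using less.hyps[OF _ cb] b by simp
    also have "g c b \<le> g c a" using g_trans[OF b pos] .
    finally show ?thesis using eq by simp
  qed
  have cf: "fmax c b = fmax c a" if "a < b" "b < c" "both c b" "below f b a" for b
    using belowD[OF that(4,2)] fmax_both[OF that(3)] fmax_both[OF less.prems] by simp
  show ?case
  proof (cases "free_between c a")
    case True
    then have comp: "compatible c a" using less.prems by (simp add: compatible_def)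
    show ?thesis
    proof (cases "minimal c a")
      case False
      \<comment> \<open>Failure of minimality yields a pivot; \<open>0 < g b a\<close> follows by
        induction, since \<open>(b, a)\<close> is compatible.\<close>
      then obtain b where b: "a < b" "b < c" "compatible b a"
        using comp by (auto simp: minimal_def)
      have ba: "both b a" using b(3) by (simp add: compatible_def)
      then have bel: "below f b a" "below f' b a"
        using I1.varies_below I2.varies_below by (auto simp: both_def)
      have "f b a < p b" "f' b a < p b"
        using ba tree_like_bounded[OF I1.h b(1)] tree_like_bounded[OF I2.h b(1)]
        by (auto simp: both_def I1.varies_def I2.varies_def)
      then have "I1.varies c b" "I2.varies c b"
        using I1.varies_between[OF _ b(1,2) bel(1)] I2.varies_between[OF _ b(1,2) bel(2)] less.prems
        by (auto simp: both_def)
      then have cb: "both c b"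
        using less.prems belowD[OF bel(1) b(2)] belowD[OF bel(2) b(2)] by (simp add: both_def)
      have "0 < g b a" using less.hyps[OF _ ba] b by fastforce
      then show ?thesis using split[OF b(1,2) cb] cf[OF b(1,2) cb bel(1)] by simp
    qed (use g_step in simp)
  next
    case False
    \<comment> \<open>Failure of freeness yields a pivot too: \<open>a\<close> is a middle
      descendant of \<open>b\<close> in one tree, and its multiplicity in the other is not
      maximal.\<close>
    then obtain b where b: "a < b" "b < c" and
      mid: "0 < f' b a \<and> f' b a < p b \<and> f b a \<noteq> p b \<or> 0 < f b a \<and> f b a < p b \<and> f' b a \<noteq> p b"
      unfolding free_between_def by blast
    have "f b a \<le> p b" "f' b a \<le> p b"
      using tree_like_bounded[OF I1.f b(1)] tree_like_bounded[OF I2.f b(1)] .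
    then have cb: "both c b"
      using both_between[OF less.prems b] swap.both_between[unfolded both_swap, OF less.prems b] mid
      by auto
    have pos: "0 < fmax b a" using mid by auto
    have "f c b = f c a"
    proof -
      have "f c b \<le> f c a" "f' c b \<le> f' c a"
        using f_mono_along_fmax[OF b(1) pos b(2)] swap.f_mono_along_fmax[of a b c] b pos by auto
      moreover have "f c a \<le> f c b \<or> f' c a \<le> f' c b"
        using tree_like_planar[OF I1.f b] tree_like_planar[OF I2.f b] mid by blast
      ultimately show ?thesis using cb less.prems by (auto simp: both_def)
    qed
    then have eq: "fmax c a = fmax c b" using fmax_both[OF cb] fmax_both[OF less.prems] by simp
    have "0 < g b a" using fmax_le[OF b(1)] pos by linarith
    then show ?thesis using split[OF b cb _ eq] by simp
  qed
qed

text \<open>Where the minimum of \<open>h\<close> and \<open>h'\<close> exceeds the maximum of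
  \<open>f\<close> and \<open>f'\<close>, both increments are one. This forces
  \<open>f c a = f' c a\<close>, so the pair falls under \<open>both_increment\<close>.\<close>

lemma meet_le:
  assumes "\<And>a b c. a < b \<Longrightarrow> b < c \<Longrightarrow> 0 < g b a \<Longrightarrow> g c b \<le> g c a"
    and "\<And>a c. a < c \<Longrightarrow> fmax c a \<le> g c a"
    and "\<And>a c. minimal c a \<Longrightarrow> fmax c a < g c a"
    and "a < c"
  shows "min (h c a) (h' c a) \<le> g c a"
proof (cases "min (h c a) (h' c a) \<le> fmax c a")
  case True
  then show ?thesis using assms(2)[OF assms(4)] by linarith
next
  case False
  then have vars: "I1.varies c a" "I2.varies c a" using assms(4) by (auto simp: I1.varies_def I2.varies_def)
  have "h c a = f c a + 1" "h' c a = f' c a + 1" using I1.varies_Suc I2.varies_Suc vars by auto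
  moreover from this have "f c a = f' c a" using False by simp
  ultimately show ?thesis using both_increment[OF assms(1-3), of c a] vars by (simp add: both_def)
qed

section \<open>Minimal compatible variations are ascents of the join\<close>

text \<open>In the second interval \<open>(c, b)\<close> varies along with \<open>(c, a)\<close>,
  and \<open>separated\<close> yields \<open>r2\<close>. This transfers the gap
  \<open>h' b a = 0\<close> to the first interval, which yields \<open>r1\<close>. The two nodes
  differ, and \<open>varies_cross\<close> applies in the interval of the smaller one.\<close>

lemma minimal_no_gap:
  assumes min: "minimal c a" and b: "a < b" "b < c" and eq: "fmax c b = fmax c a"
    and pb: "0 < p b" and z: "f b a = 0" "f' b a = 0" and h'0: "h' b a = 0"
  shows False
proof -
  have both: "both c a" and free: "free_between c a"
    using min by (auto simp: minimal_def compatible_def)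
  have none: "\<not> both x a" if "a < x" "x < c" for x
    using min that free_between_mono[OF free, of x] by (auto simp: minimal_def compatible_def)
  have v: "I1.varies c a" "I2.varies c a" "f c a = f' c a" using both by (simp_all add: both_def)
  have le: "f c b \<le> f c a" "f' c b \<le> f c a" using eq v(3) by (metis max.cobounded1 max.cobounded2 max.idem)+
  \<comment> \<open>Stated for an arbitrary \<open>increment\<close> to serve both intervals.
    Planarity of \<open>h0\<close> gives \<open>h0 c a \<le> h0 c b\<close>, and \<open>h0\<close>
    exceeds \<open>f0\<close> by at most one.\<close>
  have var_b: "varies c b \<and> f0 c a = f0 c b" 
    if "increment p f0 h0 A0" "varies = increment.varies f0 h0" "varies c a" "h0 b a = 0" "f0 c b \<le> f0 c a"
    for f0 h0 A0 varies
  proof -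
    interpret increment p f0 h0 A0 by (rule that)
    have "h0 c a \<le> h0 c b" using tree_like_planar[OF h b] that(4) pb by simp
    moreover have "h0 c b \<le> f0 c b + 1"
      using varies_Suc[of c b] b(2) by (cases "f0 c b < h0 c b") (auto simp: varies_def)
    ultimately show ?thesis
      using varies_Suc[of c a] that(2,3,5) b(2) by (auto simp: varies_def)
  qed
  have v2: "I2.varies c b" "f' c a = f' c b"
    using var_b[OF I2.increment_axioms refl v(2) h'0] le v(3) by auto
  obtain c2 r2 where r2: "b < r2" "(r2, c2) \<in> A'" "f' c2 r2 = f' c2 b" "0 < h' r2 a" "0 < f' r2 b"
      "h r2 a = 0" "I2.varies c2 a" "I2.varies c2 b"
    using swap.separated[unfolded free_between_swap both_swap, OF free none v(2) v2 b(1) pb h'0] by blast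
  have h2: "0 < h r2 b" using f'_le_h[OF r2(1)] r2(5) by simp
  \<comment> \<open>Since \<open>0 < h r2 b\<close> and \<open>h r2 a = 0\<close>, transitivity
    excludes \<open>0 < h b a\<close>.\<close>
  then have h0: "h b a = 0" using tree_like_trans[OF I1.h b(1) r2(1)] r2(6) by fastforce
  have v1: "I1.varies c b" "f c a = f c b"
    using var_b[OF I1.increment_axioms refl v(1) h0] le by auto
  obtain c1 r1 where r1: "b < r1" "(r1, c1) \<in> A" "f c1 r1 = f c1 b" "0 < h r1 a" "0 < f r1 b"
      "h' r1 a = 0" "I1.varies c1 a" "I1.varies c1 b"
    using separated[OF free none v(1) v1 b(1) pb h0] by blast
  have h1: "0 < h' r1 b" using f_le_h'[OF r1(1)] r1(5) by simp
  consider "r1 = r2" | "r1 < r2" | "r2 < r1" by linarith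
  then show False
  proof cases
    case 1 then show ?thesis using r1 r2 by simp
  next
    case 2 then show ?thesis using I1.varies_cross[OF r1(2) b(1) r1(1) 2] r1 r2(6) h2 by blast
  next
    case 3 then show ?thesis using I2.varies_cross[OF r2(2) b(1) r2(1) 3] r2 r1(6) h1 by blast
  qed
qed

end

context increment_pair
begin

interpretation swap: increment_pair p f' h' A' f h A
  by (rule increment_pair_swap)

text \<open>If \<open>fmax b a < p b\<close>, freeness leaves only
  \<open>f b a = f' b a = 0\<close>, and minimality keeps \<open>(b, a)\<close> from varying in both
  intervals. So \<open>h\<close> or \<open>h'\<close> vanishes there, and
  \<open>minimal_no_gap\<close> applies in one order or the other.\<close>

lemma minimal_between:
  assumes min: "minimal c a" and b: "a < b" "b < c" and bel: "below fmax b a"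
  shows "fmax b a = p b"
proof (rule ccontr)
  assume "fmax b a \<noteq> p b"
  then have lt: "f b a < p b" "f' b a < p b"
    using tree_like_bounded[OF tree_like_fmax b(1)] by auto
  have free: "free_between c a" and none: "\<not> both b a"
    using min b free_between_mono[of c a b] by (auto simp: minimal_def compatible_def)
  then have z: "f b a = 0" "f' b a = 0" using b lt by (auto simp: free_between_def)
  have eq: "fmax c b = fmax c a" using belowD[OF bel b(2)] by simp
  have "h b a = 0 \<or> h' b a = 0"
    using none b(1) z by (auto simp: both_def I1.varies_def I2.varies_def)
  then show False
    using minimal_no_gap[OF min b eq _ z] swap.minimal_no_gap[OF _ b _ _ z(2,1)] min eq lt
    by (auto simp: minimal_swap max.commute)
qed

text \<open>The third clause is \<open>minimal_between\<close>. For the last one, a node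
  \<open>x\<close> in the right child of \<open>a\<close> in the join would vary with
  \<open>c\<close> just as \<open>a\<close> does, in both intervals;
  \<open>right_child_empty\<close> applies in the one where \<open>x\<close> has maximal
  multiplicity at \<open>a\<close>.\<close>

lemma minimal_ascent:
  assumes "minimal c a" shows "(a, c) \<in> ascents p fmax"
proof -
  have both: "both c a" and free: "free_between c a"
    using assms by (auto simp: minimal_def compatible_def)
  have v: "I1.varies c a" "I2.varies c a" "f c a = f' c a" using both by (simp_all add: both_def)
  have ac: "a < c" using I1.variesD[OF v(1)] by simp
  have bel: "below fmax c a"
    using below_fmax I1.varies_below[OF v(1)] I2.varies_below[OF v(2)] .
  have lt: "fmax c a < p c"
    using fmax_both[OF both] I1.variesD[OF v(1)] tree_like_bounded[OF I1.h ac] by simp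
  have "\<not> below fmax a x" if pa: "0 < p a" and x: "x < a" "fmax a x = p a" for x
  proof
    assume *: "below fmax a x"
    have eq: "fmax c x = fmax c a" using belowD[OF * ac] .
    have xc: "x < c" using x ac by simp
    have pos: "0 < fmax a x" using x pa by simp
    have hx: "h c a \<le> h c x" "h' c a \<le> h' c x"
      using tree_like_trans[OF I1.h x(1) ac] tree_like_trans[OF I2.h x(1) ac] pos
        I1.f_le_h[OF x(1)] I2.f_le_h[OF x(1)] f_le_h'[OF x(1)] f'_le_h[OF x(1)] by auto
    have fx: "f c a \<le> f c x" "f' c a \<le> f' c x"
      using f_mono_along_fmax[OF x(1) pos ac] swap.f_mono_along_fmax[OF x(1) _ ac] pos by auto
    then have fx: "f c x = f c a" "f' c x = f' c a" using eq v(3) by auto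
    then have vx: "I1.varies c x" "I2.varies c x"
      using v hx xc by (auto simp: I1.varies_def I2.varies_def)
    have "f a x = p a \<or> f' a x = p a" using x(2) by (simp add: max_def split: if_splits)
    then show False
    proof
      assume "f a x = p a"
      then show False using right_child_empty[OF free v(1) vx(1) fx(1) x(1) _ pa *] by simp
    next
      assume "f' a x = p a"
      then show False
        using swap.right_child_empty[unfolded free_between_swap, OF free v(2) vx(2) fx(2) x(1) _ pa] *
        by (simp add: max.commute)
    qed
  qed
  then show ?thesis using ac bel lt minimal_between[OF assms] by (auto simp: ascents_def)
qed

end

section \<open>Transitive closure\<close>

lemma trans_path_Cons:
  "trans_path I c a (x # y # zs) \<longleftrightarrow>
     x = c \<and> y < c \<and> 0 < count I (c, y) \<and> (if zs = [] then y = a else trans_path I y a (y # zs))"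
proof -
  let ?edge = "\<lambda>bs i. i + 1 < length bs \<longrightarrow> 0 < count I (bs ! i, bs ! (i + 1))"
  have "(\<forall>i. ?edge (x # y # zs) i) \<longleftrightarrow> ?edge (x # y # zs) 0 \<and> (\<forall>i. ?edge (x # y # zs) (Suc i))"
    by (metis not0_implies_Suc)
  then have "(\<forall>i. ?edge (x # y # zs) i) \<longleftrightarrow> 0 < count I (x, y) \<and> (\<forall>i. ?edge (y # zs) i)"
    by simp
  moreover have "sorted_wrt (>) (x # y # zs) \<longleftrightarrow> y < x \<and> sorted_wrt (>) (y # zs)"
    by auto
  ultimately show ?thesis
    unfolding trans_path_def by (cases zs) auto
qed

lemma trans_path_exhaust:
  assumes "trans_path I c a bs"
  obtains y zs where "bs = c # y # zs" "y < c" "0 < count I (c, y)"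
    "zs = [] \<and> y = a \<or> trans_path I y a (y # zs)"
proof -
  obtain x y zs where bs: "bs = x # y # zs"
    using assms by (auto simp: trans_path_def Suc_le_length_iff numeral_2_eq_2)
  then show ?thesis using that[of y zs] assms by (auto simp: trans_path_Cons split: if_splits)
qed

lemma trans_path_append:
  "trans_path I c b xs \<Longrightarrow> trans_path I b a ys \<Longrightarrow> trans_path I c a (xs @ tl ys)"
proof (induction xs arbitrary: c)
  case (Cons x xs)
  obtain y zs where xs: "x # xs = c # y # zs" "y < c" "0 < count I (c, y)"
      "zs = [] \<and> y = b \<or> trans_path I y b (y # zs)"
    using trans_path_exhaust[OF Cons.prems(1)] .
  obtain y' zs' where ys: "ys = b # y' # zs'"
    using trans_path_exhaust[OF Cons.prems(2)] by metis
  from xs(4) show ?case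
  proof
    assume "zs = [] \<and> y = b"
    then show ?thesis using xs ys Cons.prems(2) by (simp add: trans_path_Cons)
  next
    assume *: "trans_path I y b (y # zs)"
    then have "trans_path I y a ((y # zs) @ tl ys)" using Cons.IH Cons.prems(2) xs(1) by simp
    then show ?thesis using xs ys by (simp add: trans_path_Cons)
  qed
qed (simp add: trans_path_def)

lemma tc_mult_ge: "trans_path I c a (c # y # zs) \<Longrightarrow> count I (c, y) \<le> tc_mult I c a"
  unfolding tc_mult_def
  by (rule Max_ge) (use finite_path_values in \<open>force intro!: exI[of _ "c # y # zs"]\<close>)+

lemma tc_mult_path:
  assumes "0 < tc_mult I c a"
  obtains y zs where "trans_path I c a (c # y # zs)" "tc_mult I c a = count I (c, y)"
proof -
  have "tc_mult I c a \<in> insert 0 {count I (bs ! 0, bs ! 1) | bs. trans_path I c a bs}"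
    unfolding tc_mult_def by (rule Max_in) (use finite_path_values in auto)
  then obtain bs where bs: "trans_path I c a bs" "tc_mult I c a = count I (bs ! 0, bs ! 1)"
    using assms by auto
  moreover obtain y zs where "bs = c # y # zs" using trans_path_exhaust[OF bs(1)] .
  ultimately show ?thesis using that[of y zs] by simp
qed

lemma tc_mult_ge_count: "a < c \<Longrightarrow> count I (c, a) \<le> tc_mult I c a"
  using tc_mult_ge[of I c a a "[]"] by (cases "count I (c, a) = 0") (auto simp: trans_path_Cons)

text \<open>Removing the first edge of an optimal path leaves a path or a single node. This is the
  origin of the axiom \<open>source\<close>.\<close>

lemma tc_mult_source:
  assumes "0 < tc_mult I c a"
  shows "\<exists>b. a \<le> b \<and> b < c \<and> tc_mult I c a = count I (c, b) \<and> (b = a \<or> 0 < tc_mult I b a)"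
  using assms
proof (induction c rule: less_induct)
  case (less c)
  obtain y zs where y: "trans_path I c a (c # y # zs)" "tc_mult I c a = count I (c, y)"
    using tc_mult_path[OF less.prems] .
  then have yc: "y < c" "zs = [] \<and> y = a \<or> trans_path I y a (y # zs)"
    by (auto simp: trans_path_Cons split: if_splits)
  have "a \<le> y \<and> (y = a \<or> 0 < tc_mult I y a)"
    using yc(2)
  proof
    assume *: "trans_path I y a (y # zs)"
    then obtain z zs' where "zs = z # zs'" "0 < count I (y, z)"
      using trans_path_exhaust[OF *] by (metis list.inject)
    then have "0 < tc_mult I y a" using tc_mult_ge[of I y a z zs'] * by (metis less_le_trans)
    then show ?thesis using less.IH[OF yc(1)] by auto
  qed simp
  then show ?case using y(2) yc(1) by auto
qed

text \<open>Appending a path does not change the first edge, which alone determines the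
  value.\<close>

lemma tc_mult_trans:
  assumes "0 < tc_mult I b a" shows "tc_mult I c b \<le> tc_mult I c a"
proof (cases "tc_mult I c b = 0")
  case False
  then obtain y zs where y: "trans_path I c b (c # y # zs)" "tc_mult I c b = count I (c, y)"
    using tc_mult_path[of I c b] by auto
  obtain y' zs' where "trans_path I b a (b # y' # zs')" using tc_mult_path[OF assms] .
  from trans_path_append[OF y(1) this] show ?thesis using tc_mult_ge y(2) by simp
qed simp

text \<open>Minimality of the closure among transitive functions above \<open>I\<close>.\<close>

lemma tc_mult_le:
  assumes h: "\<And>a b c. a < b \<Longrightarrow> b < c \<Longrightarrow> 0 < h b a \<Longrightarrow> h c b \<le> h c a"
    and le: "\<And>a c. a < c \<Longrightarrow> count I (c, a) \<le> h c a"
  shows "tc_mult I c a \<le> h c a"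
proof (induction c rule: less_induct)
  case (less c)
  show ?case
  proof (cases "tc_mult I c a = 0")
    case False
    then obtain b where b: "a \<le> b" "b < c" "tc_mult I c a = count I (c, b)" "b = a \<or> 0 < tc_mult I b a"
      using tc_mult_source[of I c a] by auto
    have "h c b \<le> h c a" using b h[of a b c] less.IH[OF b(2)] by (cases "b = a") auto
    then show ?thesis using b(3) le[OF b(2)] by simp
  qed simp
qed

text \<open>Positive values of the closure are values of \<open>I\<close>, hence bounded. For
  planarity, compare \<open>b\<close> with the second node \<open>r\<close> of an optimal path from
  \<open>c\<close> to \<open>a\<close>; if \<open>b < r\<close>, induct at \<open>r\<close>.\<close>

lemma tree_like_tc_mult:
  assumes bounded: "\<And>a c. a < c \<Longrightarrow> count I (c, a) \<le> p c"
    and planar: "\<And>a b c. a < b \<Longrightarrow> b < c \<Longrightarrow> count I (b, a) = p b \<or> count I (c, a) \<le> count I (c, b)"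
  shows "tree_like p (tc_mult I)"
proof -
  have bd: "tc_mult I c a \<le> p c" for a c
    using tc_mult_source[of I c a] bounded by (cases "tc_mult I c a = 0") auto
  have "tc_mult I b a = p b \<or> tc_mult I c a \<le> tc_mult I c b" if "a < b" "b < c" for a b c
    using that
  proof (induction c rule: less_induct)
    case (less c)
    show ?case
    proof (cases "tc_mult I c a = 0")
      case False
      then obtain r where r: "a \<le> r" "r < c" "tc_mult I c a = count I (c, r)" "r = a \<or> 0 < tc_mult I r a"
        using tc_mult_source[of I c a] by auto
      consider "r = b" | "r < b" | "b < r" by linarith
      then show ?thesis
      proof cases
        case 1
        then show ?thesis using tc_mult_ge_count[OF less.prems(2)] r(3) by simp
      next
        case 2
        from planar[OF 2 less.prems(2)] show ?thesis
        proof
          assume "count I (b, r) = p b"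
          then have "p b \<le> tc_mult I b r" using tc_mult_ge_count[OF 2, of I] by simp
          also have "tc_mult I b r \<le> tc_mult I b a" using r(4) tc_mult_trans by auto
          finally show ?thesis using bd[of b a] by simp
        next
          assume "count I (c, r) \<le> count I (c, b)"
          then show ?thesis using r(3) tc_mult_ge_count[OF less.prems(2), of I] by simp
        qed
      next
        case 3
        then have pos: "0 < tc_mult I r a" using r less.prems by auto
        from less.IH[OF r(2) less.prems(1) 3] show ?thesis
        proof
          assume "tc_mult I r a \<le> tc_mult I r b"
          then have "tc_mult I c r \<le> tc_mult I c b" using tc_mult_trans[of I r b c] pos by simp
          then show ?thesis using r(3) tc_mult_ge_count[OF r(2), of I] by simp
        qed simp
      qed
    qed simp
  qed
  then show ?thesis using bd tc_mult_trans unfolding tree_like_def by (metis neq0_conv)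
qed

text \<open>\<open>I\<close> is still planar: by \<open>ascents_between\<close> the incremented
  value at \<open>(c, a)\<close> does not exceed the one at \<open>(c, b)\<close> unless
  \<open>f b a\<close> is maximal.\<close>

lemma increment_tc_mult:
  assumes f: "tree_like p f" and A: "A \<subseteq> ascents p f"
    and I: "\<And>a c. count I (c, a) = f c a + of_bool ((a, c) \<in> A)"
  shows "increment p f (tc_mult I) A"
proof
  have asc: "(a, c) \<in> ascents p f" if "(a, c) \<in> A" for a c using A that by blast
  have bd: "count I (c, a) \<le> p c" if "a < c" for a c
    using tree_like_bounded[OF f that] asc[of a c] by (auto simp: I ascents_def)
  show "tree_like p (tc_mult I)"
  proof (rule tree_like_tc_mult[OF bd])
    fix a b c :: nat assume ab: "a < b" and bc: "b < c"
    show "count I (b, a) = p b \<or> count I (c, a) \<le> count I (c, b)"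
    proof (cases "(a, c) \<in> A")
      case True
      then show ?thesis
        using ascents_between[OF f asc[OF True] ab bc] bd[OF ab] by (auto simp: I)
    next
      case False
      then show ?thesis
        using tree_like_planar[OF f ab bc] tree_like_bounded[OF f ab] bd[OF ab] by (fastforce simp: I)
    qed
  qed
  show "f c a \<le> tc_mult I c a" if "a < c" for a c
    using tc_mult_ge_count[OF that, of I] by (simp add: I)
  show "f c a < tc_mult I c a" if "(a, c) \<in> A" for a c
    using tc_mult_ge_count[of a c I] asc[OF that] that by (auto simp: I ascents_def)
  show "\<exists>b. a \<le> b \<and> b < c \<and> tc_mult I c a = f c b + of_bool ((b, c) \<in> A) \<and> (b = a \<or> 0 < tc_mult I b a)"
    if "a < c" "0 < tc_mult I c a" for a c
    using tc_mult_source[OF that(2)] by (simp add: I)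
qed (use assms in auto)

section \<open>Decreasing trees and their inversions\<close>

lemma distinct_concat_nth:
  "distinct (concat xss) \<longleftrightarrow> (\<forall>xs\<in>set xss. distinct xs) \<and>
     (\<forall>i j. i < j \<longrightarrow> j < length xss \<longrightarrow> set (xss ! i) \<inter> set (xss ! j) = {})"
proof (induction xss)
  case (Cons xs xss)
  let ?disj = "\<lambda>xss i j. i < j \<longrightarrow> j < length xss \<longrightarrow> set (xss ! i) \<inter> set (xss ! j) = {}"
  have "(\<forall>i j. ?disj (xs # xss) i j) \<longleftrightarrow>
      (\<forall>j. ?disj (xs # xss) 0 (Suc j)) \<and> (\<forall>i j. ?disj (xs # xss) (Suc i) (Suc j))"
    by (metis not0_implies_Suc less_nat_zero_code)
  also have "(\<forall>j. ?disj (xs # xss) 0 (Suc j)) \<longleftrightarrow> set xs \<inter> set (concat xss) = {}"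
    by (fastforce simp: in_set_conv_nth)
  finally show ?case using Cons by auto
qed simp

definition node_ok :: "(nat \<Rightarrow> nat) \<Rightarrow> nat \<Rightarrow> tree list \<Rightarrow> bool" where
  "node_ok p y ts \<longleftrightarrow> length ts = p y + 1 \<and> (\<forall>t\<in>set ts. \<forall>x\<in>set (labels t). x < y)"

text \<open>No label set is prescribed, so that the notion passes to subtrees.\<close>

definition decreasing :: "(nat \<Rightarrow> nat) \<Rightarrow> tree \<Rightarrow> bool" where
  "decreasing p T \<longleftrightarrow> distinct (labels T) \<and> (\<forall>y ts. Node y ts \<in> subtrees T \<longrightarrow> node_ok p y ts)"

lemma s_trees_decreasing:
  "s_trees s = {T. decreasing (part s) T \<and> set (labels T) = {1..length s}}"
  by (auto simp: s_trees_def decreasing_def node_ok_def)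

lemma decreasing_Leaf: "decreasing p Leaf"
  by (simp add: decreasing_def)

lemma decreasing_Node:
  "decreasing p (Node m ts) \<longleftrightarrow> node_ok p m ts \<and> (\<forall>t\<in>set ts. decreasing p t) \<and>
     (\<forall>i j. i < j \<longrightarrow> j < length ts \<longrightarrow> set (labels (ts ! i)) \<inter> set (labels (ts ! j)) = {})"
proof -
  have "m \<notin> (\<Union>t\<in>set ts. set (labels t))" if "node_ok p m ts"
    using that by (auto simp: node_ok_def)
  then show ?thesis
    unfolding decreasing_def by (simp add: distinct_concat_nth) blast
qed

lemma decreasing_NodeD:
  assumes "decreasing p (Node m ts)"
  shows "length ts = p m + 1"
    and "i \<le> p m \<Longrightarrow> decreasing p (ts ! i)"
    and "i \<le> p m \<Longrightarrow> x \<in> set (labels (ts ! i)) \<Longrightarrow> x < m"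
    and "i \<le> p m \<Longrightarrow> j \<le> p m \<Longrightarrow> x \<in> set (labels (ts ! i)) \<Longrightarrow> x \<in> set (labels (ts ! j)) \<Longrightarrow> i = j"
proof -
  note dec = assms[unfolded decreasing_Node]
  show len: "length ts = p m + 1" using dec by (simp add: node_ok_def)
  then have mem: "i \<le> p m \<Longrightarrow> ts ! i \<in> set ts" by simp
  show "i \<le> p m \<Longrightarrow> decreasing p (ts ! i)"
    and "i \<le> p m \<Longrightarrow> x \<in> set (labels (ts ! i)) \<Longrightarrow> x < m"
    using mem dec by (auto simp: node_ok_def)
  show "i \<le> p m \<Longrightarrow> j \<le> p m \<Longrightarrow> x \<in> set (labels (ts ! i)) \<Longrightarrow> x \<in> set (labels (ts ! j)) \<Longrightarrow> i = j"
    using dec len by (metis Suc_eq_plus1 disjoint_iff le_imp_less_Suc linorder_neq_iff)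
qed

lemma set_labels_Node: "x \<in> set (labels (Node m ts)) \<longleftrightarrow> x = m \<or> (\<exists>i<length ts. x \<in> set (labels (ts ! i)))"
proof -
  have "(\<exists>t\<in>set ts. x \<in> set (labels t)) \<longleftrightarrow> (\<exists>i<length ts. x \<in> set (labels (ts ! i)))"
    by (metis in_set_conv_nth)
  then show ?thesis by simp
qed

lemma labels_cases:
  assumes "decreasing p (Node m ts)" "x \<in> set (labels (Node m ts))"
  obtains "x = m" | i where "i \<le> p m" "x \<in> set (labels (ts ! i))" "x < m"
proof (cases "x = m")
  case False
  then obtain i where "i < length ts" "x \<in> set (labels (ts ! i))"
    using assms(2) unfolding set_labels_Node by blast
  then have "i \<le> p m" "x \<in> set (labels (ts ! i))" using decreasing_NodeD(1)[OF assms(1)] by simp_all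
  then show ?thesis using that(2) decreasing_NodeD(3)[OF assms(1)] by blast
qed (rule that(1))

lemma Node_subtree_label: "Node y ts \<in> subtrees T \<Longrightarrow> y \<in> set (labels T)"
  by (induction T) auto

lemma subtree_labels: "t \<in> subtrees T \<Longrightarrow> set (labels t) \<subseteq> set (labels T)"
  by (induction T) auto

lemma in_child_labels: "in_child T y i a \<Longrightarrow> y \<in> set (labels T) \<and> a \<in> set (labels T)"
  unfolding in_child_def is_child_def
  using Node_subtree_label subtree_labels by (fastforce simp: set_labels_Node)

lemma in_child_Node:
  "in_child (Node m ts) y i a \<longleftrightarrow>
     y = m \<and> i < length ts \<and> a \<in> set (labels (ts ! i)) \<or> (\<exists>k<length ts. in_child (ts ! k) y i a)"
  unfolding in_child_def is_child_def by (fastforce simp: in_set_conv_nth)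

lemma in_child_root:
  assumes "decreasing p (Node m ts)"
  shows "in_child (Node m ts) m i a \<longleftrightarrow> i \<le> p m \<and> a \<in> set (labels (ts ! i))"
proof -
  have "\<not> in_child (ts ! k) m i a" if "k < length ts" for k
    using in_child_labels[of "ts ! k" m i a] decreasing_NodeD(3)[OF assms, of k m] that
      decreasing_NodeD(1)[OF assms] by auto
  then show ?thesis using decreasing_NodeD(1)[OF assms] by (auto simp: in_child_Node)
qed

lemma in_child_same:
  assumes dec: "decreasing p (Node m ts)" and k: "k \<le> p m" "y \<in> set (labels (ts ! k))"
  shows "in_child (Node m ts) y i a \<longleftrightarrow> in_child (ts ! k) y i a"
proof -
  have "y \<noteq> m" using decreasing_NodeD(3)[OF dec k] by simp
  moreover have "j = k" if "j < length ts" "in_child (ts ! j) y i a" for j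
    using in_child_labels[OF that(2)] decreasing_NodeD(4)[OF dec _ k(1) _ k(2)] that(1)
      decreasing_NodeD(1)[OF dec] by simp
  moreover have "k < length ts" using k(1) decreasing_NodeD(1)[OF dec] by simp
  ultimately show ?thesis unfolding in_child_Node by blast
qed

lemma left_of_Node:
  assumes dec: "decreasing p (Node m ts)" and k: "i \<le> p m" "a \<in> set (labels (ts ! i))"
    "j \<le> p m" "c \<in> set (labels (ts ! j))"
  shows "left_of (Node m ts) a c \<longleftrightarrow> i < j \<or> i = j \<and> left_of (ts ! i) a c"
proof -
  note D = decreasing_NodeD[OF dec]
  have root: "in_child (Node m ts) m i' a \<longleftrightarrow> i' = i" "in_child (Node m ts) m i' c \<longleftrightarrow> i' = j" for i'
    using in_child_root[OF dec] D(4) k by blast+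
  have same: "y \<noteq> m \<Longrightarrow> in_child (Node m ts) y i' a \<Longrightarrow> in_child (ts ! i) y i' a"
    "y \<noteq> m \<Longrightarrow> in_child (Node m ts) y i' c \<Longrightarrow> in_child (ts ! j) y i' c" for y i'
    unfolding in_child_Node using in_child_labels D(1,4) k
    by (metis Suc_eq_plus1 less_Suc_eq_le)+
  show ?thesis
  proof
    assume "left_of (Node m ts) a c"
    then obtain y i' j' where y: "i' < j'" "in_child (Node m ts) y i' a" "in_child (Node m ts) y j' c"
      by (auto simp: left_of_def)
    show "i < j \<or> i = j \<and> left_of (ts ! i) a c"
    proof (cases "y = m")
      case True
      then show ?thesis using y root by simp
    next
      case False
      then have *: "in_child (ts ! i) y i' a" "in_child (ts ! j) y j' c" using same y by auto
      then have "i = j" using in_child_labels D(4) k by blast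
      then show ?thesis using * y(1) by (auto simp: left_of_def)
    qed
  next
    assume "i < j \<or> i = j \<and> left_of (ts ! i) a c"
    then show "left_of (Node m ts) a c"
    proof
      assume "i < j"
      then show ?thesis using root unfolding left_of_def by blast
    next
      assume "i = j \<and> left_of (ts ! i) a c"
      then obtain y i' j' where "i' < j'" "in_child (ts ! i) y i' a" "in_child (ts ! i) y j' c"
        by (auto simp: left_of_def)
      then show ?thesis
        using in_child_same[OF dec k(1)] in_child_labels unfolding left_of_def by metis
    qed
  qed
qed

lemma tree_mult_root:
  assumes dec: "decreasing (part s) (Node m ts)" and k: "k \<le> part s m" "a \<in> set (labels (ts ! k))"
  shows "tree_mult s (Node m ts) m a = k"
proof -
  note D = decreasing_NodeD[OF dec]
  have root: "in_child (Node m ts) m i a \<longleftrightarrow> i = k" for i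
    using in_child_root[OF dec] D(4) k by blast
  have "\<not> in_child (Node m ts) y i m" for y i
    using D(1,3) in_child_labels[of _ y i m] unfolding in_child_Node
    by (metis Suc_eq_plus1 less_Suc_eq_le less_irrefl)
  then have "\<not> left_of (Node m ts) a m" "\<not> left_of (Node m ts) m a" by (auto simp: left_of_def)
  then show ?thesis using k(1) by (auto simp: tree_mult_def root)
qed

text \<open>With \<open>tree_mult_root\<close> this gives a recursion for multiplicities that the
  inductions on trees below rely on.\<close>

lemma tree_mult_child:
  assumes dec: "decreasing (part s) (Node m ts)"
    and k: "i \<le> part s m" "a \<in> set (labels (ts ! i))" "j \<le> part s m" "c \<in> set (labels (ts ! j))"
  shows "tree_mult s (Node m ts) c a =
    (if i < j then 0 else if j < i then part s c else tree_mult s (ts ! j) c a)"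
proof -
  note left = left_of_Node[OF dec k] left_of_Node[OF dec k(3,4,1,2)]
  note child = in_child_same[OF dec k(3,4)]
  have "\<not> in_child (ts ! j) c i' a" if "i \<noteq> j" for i'
    using in_child_labels[of "ts ! j" c i' a] decreasing_NodeD(4)[OF dec k(1,3,2)] that by blast
  then show ?thesis by (auto simp: tree_mult_def left child)
qed

lemma decreasing_tree_mult_le:
  assumes "decreasing (part s) T" "a \<in> set (labels T)" "c \<in> set (labels T)" "a < c"
  shows "tree_mult s T c a \<le> part s c"
  using assms
proof (induction T)
  case (Node m ts)
  note dec = Node.prems(1) and D = decreasing_NodeD[OF Node.prems(1)]
  from dec Node.prems(3) show ?case
  proof (cases rule: labels_cases)
    case 1
    from dec Node.prems(2) show ?thesis
      by (cases rule: labels_cases) (use 1 Node.prems(4) tree_mult_root[OF dec] in auto)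
  next
    case c: (2 j)
    from dec Node.prems(2) show ?thesis
    proof (cases rule: labels_cases)
      case a: (2 i)
      then show ?thesis using Node.IH[of "ts ! j"] D Node.prems(4) c
        by (auto simp: tree_mult_child[OF dec a(1,2) c(1,2)])
    qed (use c Node.prems in simp)
  qed
qed simp

text \<open>If \<open>c\<close> is the root, its multiplicities are the child indices of
  \<open>a\<close> and \<open>b\<close>, whose order decides whether \<open>(b, a)\<close> is 0 or
  maximal when they differ. Nodes in one common child are left to induction.\<close>

lemma decreasing_tree_mult_trans:
  assumes "decreasing (part s) T" "a \<in> set (labels T)" "b \<in> set (labels T)" "c \<in> set (labels T)"
    "a < b" "b < c"
  shows "(tree_mult s T b a = 0 \<or> tree_mult s T c b \<le> tree_mult s T c a) \<and>
    (tree_mult s T b a = part s b \<or> tree_mult s T c a \<le> tree_mult s T c b)"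
  using assms
proof (induction T)
  case (Node m ts)
  note dec = Node.prems(1) and D = decreasing_NodeD[OF Node.prems(1)]
  note le = decreasing_tree_mult_le[OF dec]
  have "c \<le> m" using dec Node.prems(4) by (cases rule: labels_cases) auto
  obtain i where i: "i \<le> part s m" "a \<in> set (labels (ts ! i))"
    using dec Node.prems(2) by (cases rule: labels_cases) (use \<open>c \<le> m\<close> Node.prems in auto)
  obtain j where j: "j \<le> part s m" "b \<in> set (labels (ts ! j))"
    using dec Node.prems(3) by (cases rule: labels_cases) (use \<open>c \<le> m\<close> Node.prems in auto)
  note ba = tree_mult_child[OF dec i j]
  from dec Node.prems(4) show ?case
  proof (cases rule: labels_cases)
    case 1
    then show ?thesis using tree_mult_root[OF dec i] tree_mult_root[OF dec j] ba by auto
  next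
    case c: (2 k)
    note ca = tree_mult_child[OF dec i c(1,2)] and cb = tree_mult_child[OF dec j c(1,2)]
    show ?thesis
    proof (cases "i = j \<and> j = k")
      case True
      then show ?thesis using Node.IH[of "ts ! k"] D i j c Node.prems(5,6) ba ca cb by simp
    next
      case False
      then show ?thesis
        using le[OF Node.prems(3,4)] le[OF Node.prems(2,4)] Node.prems(5,6) ba ca cb
        by (auto split: if_splits)
    qed
  qed
qed simp

text \<open>A node having \<open>a\<close> and \<open>c\<close> in different children tells them
  apart by its multiplicities. Within one child, both sides are inherited from that child.\<close>

lemma in_child_iff:
  assumes "decreasing (part s) T" "a \<in> set (labels T)" "c \<in> set (labels T)"
  shows "in_child T c i a \<longleftrightarrow> a < c \<and> tree_mult s T c a = i \<and>
    (\<forall>y\<in>set (labels T). c < y \<longrightarrow> tree_mult s T y a = tree_mult s T y c)"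
  using assms
proof (induction T)
  case (Node m ts)
  note dec = Node.prems(1) and D = decreasing_NodeD[OF Node.prems(1)]
  from dec Node.prems(3) show ?case
  proof (cases rule: labels_cases)
    case 1
    have no: "\<not> m < y" if "y \<in> set (labels (Node m ts))" for y
      using dec that by (cases rule: labels_cases) auto
    from dec Node.prems(2) show ?thesis
    proof (cases rule: labels_cases)
      case a: 1
      then show ?thesis using 1 in_child_root[OF dec, of i m] D(3)[of i m] by auto
    next
      case a: (2 k)
      then show ?thesis
        using 1 in_child_root[OF dec, of i a] tree_mult_root[OF dec a(1,2)] D(4)[of k i a] no by auto
    qed
  next
    case c: (2 k)
    have child: "in_child (Node m ts) c i a \<longleftrightarrow> in_child (ts ! k) c i a"
      using in_child_same[OF dec c(1,2)] .
    from dec Node.prems(2) show ?thesis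
    proof (cases rule: labels_cases)
      case a: 1
      then show ?thesis using child in_child_labels[of "ts ! k" c i m] D(3)[of k m] c by auto
    next
      case a: (2 j)
      show ?thesis
      proof (cases "j = k")
        case False
        have "\<not> in_child (ts ! k) c i a"
          using in_child_labels[of "ts ! k" c i a] D(4)[OF a(1) c(1) a(2)] False by blast
        moreover have "tree_mult s (Node m ts) m a \<noteq> tree_mult s (Node m ts) m c"
          using False tree_mult_root[OF dec a(1,2)] tree_mult_root[OF dec c(1,2)] by simp
        ultimately show ?thesis using child c(3) by auto
      next
        case True
        have ak: "a \<in> set (labels (ts ! k))" using a True by simp
        have "(\<forall>y\<in>set (labels (Node m ts)). c < y \<longrightarrow>
              tree_mult s (Node m ts) y a = tree_mult s (Node m ts) y c) \<longleftrightarrow>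
            (\<forall>y\<in>set (labels (ts ! k)). c < y \<longrightarrow> tree_mult s (ts ! k) y a = tree_mult s (ts ! k) y c)"
          (is "?L \<longleftrightarrow> ?R")
        proof
          assume L: ?L
          have "k < length ts" using c(1) D(1) by simp
          then have "y \<in> set (labels (Node m ts))" if "y \<in> set (labels (ts ! k))" for y
            using that unfolding set_labels_Node by blast
          moreover have "tree_mult s (Node m ts) y a = tree_mult s (ts ! k) y a"
            "tree_mult s (Node m ts) y c = tree_mult s (ts ! k) y c" if "y \<in> set (labels (ts ! k))" for y
            using tree_mult_child[OF dec c(1) ak c(1) that] tree_mult_child[OF dec c(1,2) c(1) that]
            by simp_all
          ultimately show ?R using L by metis
        next
          assume R: ?R
          show ?L
          proof (intro ballI impI)
            fix y assume y: "y \<in> set (labels (Node m ts))" "c < y"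
            from dec y(1) show "tree_mult s (Node m ts) y a = tree_mult s (Node m ts) y c"
            proof (cases rule: labels_cases)
              case 1
              then show ?thesis using tree_mult_root[OF dec c(1)] ak c(2) by simp
            next
              case (2 l)
              then show ?thesis
                using tree_mult_child[OF dec c(1) ak 2(1,2)] tree_mult_child[OF dec c(1,2) 2(1,2)] R y(2)
                by auto
            qed
          qed
        qed
        moreover have "tree_mult s (Node m ts) c a = tree_mult s (ts ! k) c a"
          using tree_mult_child[OF dec c(1) ak c(1,2)] by simp
        moreover have "ts ! k \<in> set ts" using c(1) D(1) by simp
        ultimately show ?thesis using Node.IH[of "ts ! k"] D(2)[OF c(1)] ak c(2) child by simp
      qed
    qed
  qed
qed simp

text \<open>The root is the largest label, and its multiplicities distribute the other labels among
  the children.\<close>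

lemma decreasing_unique:
  assumes "decreasing (part s) T" "decreasing (part s) U" "set (labels T) = set (labels U)"
    and "\<And>a c. a \<in> set (labels T) \<Longrightarrow> c \<in> set (labels T) \<Longrightarrow> a < c \<Longrightarrow>
      tree_mult s T c a = tree_mult s U c a"
  shows "T = U"
  using assms
proof (induction T arbitrary: U)
  case Leaf
  then show ?case by (cases U) auto
next
  case (Node m ts)
  then obtain m' us where U: "U = Node m' us" by (cases U) auto
  note dT = Node.prems(1) and dU = Node.prems(2)[unfolded U]
  note DT = decreasing_NodeD[OF dT] and DU = decreasing_NodeD[OF dU]
  have le: "x \<le> m" if "x \<in> set (labels (Node m ts))" for x
    using dT that by (cases rule: labels_cases) auto
  have le': "x \<le> m'" if "x \<in> set (labels (Node m' us))" for x
    using dU that by (cases rule: labels_cases) auto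
  have m: "m' = m" using le[of m'] le'[of m] Node.prems(3) U set_labels_Node by (metis order_antisym)
  note dU = dU[unfolded m] and DU = DU[unfolded m]
  \<comment> \<open>Stated for any tree with root \<open>m\<close>, to be used for both
    trees.\<close>
  have fT: "x \<in> set (labels (ts ! k)) \<longleftrightarrow> x \<in> set (labels T) \<and> x < m \<and> tree_mult s T m x = k"
    if T: "T = Node m ts" "decreasing (part s) T" and k: "k \<le> part s m" for x k ts T
  proof -
    note D = decreasing_NodeD[OF T(2)[unfolded T(1)]]
    show ?thesis
    proof
      assume x: "x \<in> set (labels (ts ! k))"
      have "k < length ts" using D(1) k by simp
      then show "x \<in> set (labels T) \<and> x < m \<and> tree_mult s T m x = k"
        using x D(3)[OF k x] tree_mult_root[OF T(2)[unfolded T(1)] k x] T(1)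
        unfolding T(1) set_labels_Node by blast
    next
      assume x: "x \<in> set (labels T) \<and> x < m \<and> tree_mult s T m x = k"
      then have "x \<in> set (labels (Node m ts))" unfolding T(1) by blast
      with T(2)[unfolded T(1)] show "x \<in> set (labels (ts ! k))"
        by (cases rule: labels_cases)
          (use x tree_mult_root[OF T(2)[unfolded T(1)]] T(1) in auto)
    qed
  qed
  have m_in: "m \<in> set (labels (Node m ts))" by simp
  have "ts ! k = us ! k" if k: "k \<le> part s m" for k
  proof (rule Node.IH)
    show "ts ! k \<in> set ts" using k DT(1) by simp
    show "decreasing (part s) (ts ! k)" "decreasing (part s) (us ! k)" using DT(2) DU(2) k by auto
    show eq: "set (labels (ts ! k)) = set (labels (us ! k))"
    proof (intro equalityI subsetI)
      fix x assume "x \<in> set (labels (ts ! k))"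
      then show "x \<in> set (labels (us ! k))"
        using fT[OF refl dT k] fT[OF refl dU k] Node.prems(3,4) m_in unfolding U m by metis
    next
      fix x assume "x \<in> set (labels (us ! k))"
      then show "x \<in> set (labels (ts ! k))"
        using fT[OF refl dT k] fT[OF refl dU k] Node.prems(3,4) m_in unfolding U m by metis
    qed
    show "tree_mult s (ts ! k) c a = tree_mult s (us ! k) c a"
      if ac: "a \<in> set (labels (ts ! k))" "c \<in> set (labels (ts ! k))" "a < c" for a c
    proof -
      have "tree_mult s (Node m ts) c a = tree_mult s U c a"
        using Node.prems(4) ac fT[OF refl dT k] by blast
      then show ?thesis
        using tree_mult_child[OF dT k ac(1) k ac(2)] tree_mult_child[OF dU k _ k, of a c] ac eq U m
        by simp
    qed
  qed
  then show ?case using U m DT(1) DU(1) by (simp add: list_eq_iff_nth_eq)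
qed

text \<open>The largest label becomes the root, and child \<open>i\<close> is built from the labels
  of value \<open>i\<close> there. Across different children, transitivity yields 0 and planarity
  the maximal value, as the tree demands.\<close>

lemma decreasing_exists:
  assumes f: "tree_like (part s) f" and "finite N"
  shows "\<exists>T. decreasing (part s) T \<and> set (labels T) = N \<and>
    (\<forall>a\<in>N. \<forall>c\<in>N. a < c \<longrightarrow> tree_mult s T c a = f c a)"
  using assms(2)
proof (induction "card N" arbitrary: N rule: less_induct)
  case less
  show ?case
  proof (cases "N = {}")
    case True
    then show ?thesis using decreasing_Leaf by (intro exI[of _ Leaf]) simp
  next
    case False
    define m where "m = Max N"
    define C where "C i = {a \<in> N. a < m \<and> f m a = i}" for i
    have m: "m \<in> N" "\<And>x. x \<in> N \<Longrightarrow> x \<le> m" using less.prems False by (auto simp: m_def)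
    have "\<exists>T. decreasing (part s) T \<and> set (labels T) = C i \<and>
      (\<forall>a\<in>C i. \<forall>c\<in>C i. a < c \<longrightarrow> tree_mult s T c a = f c a)" for i
    proof (rule less.hyps)
      show "card (C i) < card N"
        by (rule psubset_card_mono) (use less.prems m(1) in \<open>auto simp: C_def\<close>)
      show "finite (C i)" using less.prems by (simp add: C_def)
    qed
    then obtain t where t: "\<And>i. decreasing (part s) (t i)" "\<And>i. set (labels (t i)) = C i"
        "\<And>i a c. a \<in> C i \<Longrightarrow> c \<in> C i \<Longrightarrow> a < c \<Longrightarrow> tree_mult s (t i) c a = f c a"
      by metis
    define ts where "ts = map t [0..<part s m + 1]"
    have nth: "ts ! i = t i" if "i \<le> part s m" for i
      using that by (simp add: ts_def del: upt_Suc)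
    have len: "length ts = part s m + 1" by (simp add: ts_def)
    have mem: "\<exists>i. x = t i" if "x \<in> set ts" for x using that by (auto simp: ts_def)
    have dec: "decreasing (part s) (Node m ts)"
      unfolding decreasing_Node node_ok_def
    proof (intro conjI allI impI ballI)
      show "x < m" if "y \<in> set ts" "x \<in> set (labels y)" for x y
        using mem[OF that(1)] that(2) t(2) by (auto simp: C_def)
      show "set (labels (ts ! i)) \<inter> set (labels (ts ! j)) = {}" if "i < j" "j < length ts" for i j
        using that by (auto simp: len nth t(2) C_def)
    qed (use len mem t(1) in auto)
    have mem_child: "a \<in> set (labels (ts ! f m a)) \<and> f m a \<le> part s m" if "a \<in> N" "a < m" for a
      using that nth t(2) tree_like_bounded[OF f that(2)] by (simp add: C_def)
    have labels: "set (labels (Node m ts)) = N"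
    proof (intro equalityI subsetI)
      fix x assume "x \<in> set (labels (Node m ts))"
      with dec show "x \<in> N"
        by (cases rule: labels_cases) (use m(1) nth t(2) in \<open>auto simp: C_def\<close>)
    next
      fix x assume "x \<in> N"
      then show "x \<in> set (labels (Node m ts))"
        using mem_child[of x] m(2)[of x] len unfolding set_labels_Node
        by (metis Suc_eq_plus1 le_imp_less_Suc le_neq_implies_less)
    qed
    have "tree_mult s (Node m ts) c a = f c a" if ac: "a \<in> N" "c \<in> N" "a < c" for a c
    proof -
      have am: "a < m" using ac m(2)[of c] by simp
      note a = mem_child[OF ac(1) am]
      show ?thesis
      proof (cases "c = m")
        case True
        then show ?thesis using tree_mult_root[OF dec] a by blast
      next
        case False
        then have cm: "c < m" using ac m(2)[of c] by simp
        note c = mem_child[OF ac(2) cm]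
        note eq = tree_mult_child[OF dec conjunct2[OF a] conjunct1[OF a] conjunct2[OF c] conjunct1[OF c]]
        consider "f m a < f m c" | "f m c < f m a" | "f m a = f m c" by linarith
        then show ?thesis
        proof cases
          case 1
          then show ?thesis using eq tree_like_trans[OF f ac(3) cm] by fastforce
        next
          case 2
          then show ?thesis
            using eq tree_like_planar[OF f ac(3) cm] tree_like_bounded[OF f ac(3)] by fastforce
        next
          case 3
          then show ?thesis using eq t(3)[of a "f m c" c] ac am cm c nth by (simp add: C_def)
        qed
      qed
    qed
    then show ?thesis using dec labels by blast
  qed
qed

lemma label_subtree: "a \<in> set (labels T) \<Longrightarrow> \<exists>ts. Node a ts \<in> subtrees T"
  by (induction T) (simp, fastforce)

lemma decreasing_Node_unique:
  assumes "decreasing p T" "Node a ts \<in> subtrees T" "Node a us \<in> subtrees T"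
  shows "ts = us"
  using assms
proof (induction T)
  case (Node m vs)
  note D = decreasing_NodeD[OF Node.prems(1)]
  have child: "\<exists>i\<le>p m. Node a ws \<in> subtrees (vs ! i)" if "Node a ws \<in> subtrees (Node m vs)" "Node a ws \<noteq> Node m vs" for ws
    using that D(1) by (auto simp: in_set_conv_nth less_Suc_eq_le)
  have no: "\<not> Node m ws \<in> subtrees (vs ! i)" if "i \<le> p m" for ws i
    using D(3)[OF that, of m] Node_subtree_label[of m ws "vs ! i"] by auto
  show ?case
  proof (cases "a = m")
    case True
    then show ?thesis using child[OF Node.prems(2)] child[OF Node.prems(3)] no by auto
  next
    case False
    then obtain i j where i: "i \<le> p m" "Node a ts \<in> subtrees (vs ! i)"
      and j: "j \<le> p m" "Node a us \<in> subtrees (vs ! j)"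
      using child[OF Node.prems(2)] child[OF Node.prems(3)] by auto
    then have "i = j" using D(4)[OF i(1) j(1)] Node_subtree_label by blast
    moreover have "vs ! i \<in> set vs" using i(1) D(1) by simp
    ultimately show ?thesis using Node.IH D(2)[OF i(1)] i j by blast
  qed
qed simp

lemma is_child_Leaf_iff:
  assumes "decreasing p T" "a \<in> set (labels T)"
  shows "is_child T a (p a) Leaf \<longleftrightarrow> (\<forall>x. \<not> in_child T a (p a) x)"
proof -
  obtain ts where ts: "Node a ts \<in> subtrees T" using label_subtree[OF assms(2)] by blast
  then have len: "p a < length ts" using assms(1) by (simp add: decreasing_def node_ok_def)
  have "is_child T a (p a) t \<longleftrightarrow> ts ! p a = t" for t
    unfolding is_child_def using ts len decreasing_Node_unique[OF assms(1) ts] by blast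
  moreover have "ts ! p a = Leaf \<longleftrightarrow> set (labels (ts ! p a)) = {}" by (cases "ts ! p a") auto
  ultimately show ?thesis by (auto simp: in_child_def)
qed

section \<open>Tree notions in terms of inversion functions\<close>

lemma card_inv_outside: "(c, a) \<notin> node_pairs s \<Longrightarrow> card_inv s T c a = 0"
  by (simp add: count_inv)

lemma card_inv_inside: "(c, a) \<in> node_pairs s \<Longrightarrow> card_inv s T c a = tree_mult s T c a"
  by (simp add: count_inv)

lemma tree_like_card_inv:
  assumes "T \<in> s_trees s" shows "tree_like (part s) (card_inv s T)"
proof -
  have dec: "decreasing (part s) T" and lab: "set (labels T) = {1..length s}"
    using assms by (auto simp: s_trees_decreasing)
  have "card_inv s T c a \<le> part s c" for a c
    using decreasing_tree_mult_le[OF dec] lab by (auto simp: count_inv node_pairs_def)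
  moreover have "(card_inv s T b a = 0 \<or> card_inv s T c b \<le> card_inv s T c a) \<and>
      (card_inv s T b a = part s b \<or> card_inv s T c a \<le> card_inv s T c b)" if "a < b" "b < c" for a b c
    using decreasing_tree_mult_trans[OF dec _ _ _ that] that lab by (auto simp: count_inv node_pairs_def)
  ultimately show ?thesis unfolding tree_like_def by blast
qed

lemma in_child_card_inv:
  assumes "T \<in> s_trees s"
  shows "in_child T c i a \<longleftrightarrow>
    (c, a) \<in> node_pairs s \<and> card_inv s T c a = i \<and> below (card_inv s T) c a"
proof (cases "a \<in> {1..length s} \<and> c \<in> {1..length s} \<and> a < c")
  case True
  have dec: "decreasing (part s) T" and lab: "set (labels T) = {1..length s}"
    using assms by (auto simp: s_trees_decreasing)
  have "below (card_inv s T) c a \<longleftrightarrow>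
      (\<forall>y\<in>set (labels T). c < y \<longrightarrow> tree_mult s T y a = tree_mult s T y c)"
    using True lab by (auto simp: below_def count_inv node_pairs_def)
  moreover have "(c, a) \<in> node_pairs s" using True by (simp add: node_pairs_def)
  ultimately show ?thesis
    using in_child_iff[OF dec, of a c i] True lab by (simp add: card_inv_inside)
next
  case False
  have "\<not> in_child T c i a"
  proof
    assume *: "in_child T c i a"
    then have "a \<in> set (labels T)" "c \<in> set (labels T)" using in_child_labels by auto
    then show False using * False assms in_child_iff[of s T a c i] by (simp add: s_trees_decreasing)
  qed
  moreover have "(c, a) \<notin> node_pairs s" using False by (auto simp: node_pairs_def)
  ultimately show ?thesis by simp
qed

lemma descendant_card_inv:
  "T \<in> s_trees s \<Longrightarrow> descendant T c a \<longleftrightarrow> (c, a) \<in> node_pairs s \<and> below (card_inv s T) c a"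
  by (auto simp: descendant_def in_child_card_inv)

lemma middle_descendant_card_inv:
  assumes "T \<in> s_trees s"
  shows "middle_descendant s T b a \<longleftrightarrow> 0 < card_inv s T b a \<and> card_inv s T b a < part s b"
proof -
  have "(b, a) \<in> node_pairs s \<and> below (card_inv s T) b a"
    if "0 < card_inv s T b a" "card_inv s T b a < part s b"
  proof -
    have "(b, a) \<in> node_pairs s" using that(1) card_inv_outside by (metis less_not_refl)
    moreover from this have "a < b" by (simp add: node_pairs_def)
    ultimately show ?thesis using tree_like_middle_below[OF tree_like_card_inv[OF assms] _ that] by blast
  qed
  then show ?thesis using assms by (auto simp: middle_descendant_def in_child_card_inv)
qed

text \<open>\<open>ascents\<close> ranges over all naturals, hence the restriction to
  \<open>node_pairs s\<close>.\<close>

lemma tree_ascents_card_inv: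
  assumes T: "T \<in> s_trees s"
  shows "tree_ascents s T = {(a, c) \<in> ascents (part s) (card_inv s T). (c, a) \<in> node_pairs s}"
proof -
  let ?f = "card_inv s T"
  note tl = tree_like_card_inv[OF T]
  have dec: "decreasing (part s) T" and lab: "set (labels T) = {1..length s}"
    using T by (auto simp: s_trees_decreasing)
  have "(a, c) \<in> tree_ascents s T \<longleftrightarrow> (a, c) \<in> ascents (part s) ?f" if ca: "(c, a) \<in> node_pairs s" for a c
  proof -
    have ac: "a < c" "a \<in> set (labels T)" using ca lab by (auto simp: node_pairs_def)
    have between: "(b, a) \<in> node_pairs s" if "a < b" "b < c" for b
      using ca that by (auto simp: node_pairs_def)
    have leaf: "is_child T a (part s a) Leaf \<longleftrightarrow> (\<forall>x<a. ?f a x = part s a \<longrightarrow> \<not> below ?f a x)"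
      if "0 < part s a"
    proof -
      have "(a, x) \<in> node_pairs s" if "?f a x = part s a" for x
        using that card_inv_outside[of a x s T] \<open>0 < part s a\<close> by (metis less_irrefl)
      then have "(a, x) \<in> node_pairs s \<and> ?f a x = part s a \<longleftrightarrow> x < a \<and> ?f a x = part s a" for x
        by (auto simp: node_pairs_def)
      then show ?thesis
        unfolding is_child_Leaf_iff[OF dec ac(2)] in_child_card_inv[OF T] by blast
    qed
    have "?f c a \<noteq> part s c \<longleftrightarrow> ?f c a < part s c" using tree_like_bounded[OF tl ac(1)] by auto
    then show ?thesis
      using ca ac(1) between leaf
      by (auto simp: tree_ascents_def ascents_def descendant_card_inv[OF T] in_child_card_inv[OF T])
  qed
  moreover have "(c, a) \<in> node_pairs s" if "(a, c) \<in> tree_ascents s T" for a c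
    using that descendant_card_inv[OF T] by (auto simp: tree_ascents_def)
  ultimately show ?thesis by auto
qed

lemma s_trees_eqI:
  assumes "T \<in> s_trees s" "U \<in> s_trees s" "\<And>a c. a < c \<Longrightarrow> card_inv s T c a = card_inv s U c a"
  shows "T = U"
proof (rule decreasing_unique)
  show "tree_mult s T c a = tree_mult s U c a"
    if "a \<in> set (labels T)" "c \<in> set (labels T)" "a < c" for a c
  proof -
    have "(c, a) \<in> node_pairs s" using that assms(1) by (auto simp: s_trees_decreasing node_pairs_def)
    then show ?thesis using assms(3)[OF that(3)] by (simp add: card_inv_inside)
  qed
qed (use assms in \<open>auto simp: s_trees_decreasing\<close>)

lemma s_trees_exists:
  assumes "tree_like (part s) f" "\<And>a c. (c, a) \<notin> node_pairs s \<Longrightarrow> f c a = 0"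
  shows "\<exists>T\<in>s_trees s. \<forall>a c. card_inv s T c a = f c a"
proof -
  obtain T where T: "decreasing (part s) T" "set (labels T) = {1..length s}"
      "\<And>a c. a \<in> {1..length s} \<Longrightarrow> c \<in> {1..length s} \<Longrightarrow> a < c \<Longrightarrow> tree_mult s T c a = f c a"
    using decreasing_exists[OF assms(1), of "{1..length s}"] by auto
  have "card_inv s T c a = f c a" for a c
    using T(3)[of a c] assms(2)[of c a] by (auto simp: count_inv node_pairs_def)
  then show ?thesis using T by (auto simp: s_trees_decreasing)
qed

text \<open>The description in \<open>tree_plus\<close> denotes a tree: existence comes from
  \<open>s_trees_exists\<close>, uniqueness from \<open>s_trees_eqI\<close>.\<close>

lemma tree_plus_card_inv:
  assumes T: "T \<in> s_trees s" and A: "A \<subseteq> tree_ascents s T"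
  defines "I \<equiv> tree_inv s T + mset_set (A\<inverse>)"
  shows "tree_plus s T A \<in> s_trees s"
    and "card_inv s (tree_plus s T A) c a = tc_mult I c a"
    and "count I (c, a) = card_inv s T c a + of_bool ((a, c) \<in> A)"
    and "increment (part s) (card_inv s T) (card_inv s (tree_plus s T A)) A"
proof -
  have pairs: "(c, a) \<in> node_pairs s" if "(a, c) \<in> A" for a c
    using A that tree_ascents_card_inv[OF T] by auto
  then have "A\<inverse> \<subseteq> node_pairs s" by auto
  then have "finite (A\<inverse>)" using finite_node_pairs finite_subset by blast
  then show I: "count I (c, a) = card_inv s T c a + of_bool ((a, c) \<in> A)" for c a
    by (simp add: I_def)
  have inc: "increment (part s) (card_inv s T) (tc_mult I) A"
    using increment_tc_mult[OF tree_like_card_inv[OF T] _ I] A tree_ascents_card_inv[OF T] by auto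
  \<comment> \<open>The edges of a path are inversions of \<open>T\<close> or ascents in
    \<open>A\<close>, so the closure stays within the node pairs.\<close>
  have node: "(c, a) \<in> node_pairs s" if "0 < tc_mult I c a" for c a
    using that
  proof (induction c rule: less_induct)
    case (less c)
    obtain b where b: "b < c" "tc_mult I c a = count I (c, b)" "b = a \<or> 0 < tc_mult I b a"
      using tc_mult_source[OF less.prems] by blast
    have "(c, b) \<in> node_pairs s"
    proof (cases "(b, c) \<in> A")
      case False
      then have "0 < card_inv s T c b" using I[of c b] b(2) less.prems by simp
      then show ?thesis using card_inv_outside by (metis less_irrefl)
    qed (rule pairs)
    then show ?case using b less.IH[OF b(1)] by (auto simp: node_pairs_def)
  qed
  have "tree_like (part s) (tc_mult I)" using inc by (simp add: increment_def)
  moreover have "tc_mult I c a = 0" if "(c, a) \<notin> node_pairs s" for a c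
    using node[of c a] that by auto
  ultimately obtain U where U: "U \<in> s_trees s" "\<And>a c. card_inv s U c a = tc_mult I c a"
    using s_trees_exists[of s "tc_mult I"] by blast
  have "tree_inv s U = tc I"
    by (rule multiset_eqI) (auto simp: U(2) count_tc)
  moreover have "V = U" if "V \<in> s_trees s" "tree_inv s V = tc I" for V
    using s_trees_eqI[OF that(1) U(1)] that(2) U(2) by (simp add: count_tc)
  ultimately have "tree_plus s T A = U"
    unfolding tree_plus_def I_def[symmetric] using U(1) by blast
  then show "tree_plus s T A \<in> s_trees s" "card_inv s (tree_plus s T A) c a = tc_mult I c a"
    "increment (part s) (card_inv s T) (card_inv s (tree_plus s T A)) A" for c a
    using U inc by auto
qed

lemma le_weak_order:
  "R \<sqsubseteq>\<^bsub>weak_order s\<^esub> T \<longleftrightarrow> (\<forall>c a. a < c \<longrightarrow> card_inv s R c a \<le> card_inv s T c a)"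
  and carrier_weak_order: "carrier (weak_order s) = s_trees s"
  by (simp_all add: weak_order_def)

text \<open>The join is a chosen least upper bound; \<open>U\<close> is one, and antisymmetry leaves
  no other choice.\<close>

lemma join_weak_order:
  assumes "T \<in> s_trees s" "T' \<in> s_trees s" "U \<in> s_trees s"
    and U: "\<And>a c. card_inv s U c a = max (card_inv s T c a) (card_inv s T' c a)"
  shows "T \<squnion>\<^bsub>weak_order s\<^esub> T' = U"
proof -
  have lub: "least (weak_order s) U (Upper (weak_order s) {T, T'})"
    using assms by (auto simp: least_def Upper_def le_weak_order carrier_weak_order)
  moreover have "V = U" if "least (weak_order s) V (Upper (weak_order s) {T, T'})" for V
  proof (rule s_trees_eqI)
    have "V \<in> Upper (weak_order s) {T, T'}" "U \<in> Upper (weak_order s) {T, T'}"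
      using that lub by (auto simp: least_def)
    then have le: "V \<sqsubseteq>\<^bsub>weak_order s\<^esub> U" "U \<sqsubseteq>\<^bsub>weak_order s\<^esub> V" "V \<in> s_trees s"
      using that lub by (auto simp: least_def Upper_def carrier_weak_order)
    then show "V \<in> s_trees s" by simp
    show "card_inv s V c a = card_inv s U c a" if "a < c" for a c
      using le that by (simp add: le_weak_order order_antisym)
  qed (rule assms(3))
  ultimately show ?thesis
    unfolding join_def sup_def by (rule some_equality)
qed

lemma pure_interval_iff:
  "R \<in> pure_interval s T A \<longleftrightarrow> R \<in> s_trees s \<and>
    (\<forall>c a. a < c \<longrightarrow> card_inv s T c a \<le> card_inv s R c a \<and>
      card_inv s R c a \<le> card_inv s (tree_plus s T A) c a)"
  by (auto simp: pure_interval_def at_least_at_most_def le_weak_order carrier_weak_order)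

section \<open>Intersection of pure intervals\<close>

theorem corollary4p13:
  fixes s :: "nat list" and T T' T'' :: tree and A A' A'' :: "(nat \<times> nat) set"
  assumes "T \<in> s_trees s" and "A \<subseteq> tree_ascents s T"
    and "T' \<in> s_trees s" and "A' \<subseteq> tree_ascents s T'"
    and "pure_interval s T A \<inter> pure_interval s T' A' \<noteq> {}"
    and "T'' = T \<squnion>\<^bsub>weak_order s\<^esub> T'"
    and "A'' = minimal_compatible s T A T' A'"
  shows "T'' \<in> s_trees s \<and> A'' \<subseteq> tree_ascents s T'' \<and>
    pure_interval s T A \<inter> pure_interval s T' A' = pure_interval s T'' A''"
proof -
  let ?f = "card_inv s T" and ?h = "card_inv s (tree_plus s T A)"
  let ?f' = "card_inv s T'" and ?h' = "card_inv s (tree_plus s T' A')"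
  interpret I1: increment "part s" ?f ?h A by (rule tree_plus_card_inv(4)[OF assms(1,2)])
  interpret I2: increment "part s" ?f' ?h' A' by (rule tree_plus_card_inv(4)[OF assms(3,4)])
  obtain R where "R \<in> pure_interval s T A" "R \<in> pure_interval s T' A'" using assms(5) by blast
  then have "?f c a \<le> ?h' c a \<and> ?f' c a \<le> ?h c a" if "a < c" for a c
    using that unfolding pure_interval_iff by (meson le_trans)
  then interpret increment_pair "part s" ?f ?h A ?f' ?h' A'
    by unfold_locales auto
  have "fmax c a = 0" if "(c, a) \<notin> node_pairs s" for a c
    using that by (simp add: card_inv_outside)
  then have "\<exists>U\<in>s_trees s. \<forall>a c. card_inv s U c a = fmax c a"
    by (rule s_trees_exists[OF tree_like_fmax])
  then obtain U where U: "U \<in> s_trees s" "\<forall>a c. card_inv s U c a = fmax c a" ..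
  have T'': "T'' = U" unfolding assms(6) by (rule join_weak_order[OF assms(1,3) U(1)]) (simp add: U(2))
  have vars: "variation s T (tree_plus s T A) c a v \<longleftrightarrow> I1.varies c a \<and> v = ?f c a"
    "variation s T' (tree_plus s T' A') c a v \<longleftrightarrow> I2.varies c a \<and> v = ?f' c a" for c a v
    unfolding variation_def I1.varies_def I2.varies_def by blast+
  have free: "(\<forall>b. a < b \<and> b < c \<longrightarrow>
      (middle_descendant s T' b a \<longrightarrow> ?f b a = part s b) \<and>
      (middle_descendant s T b a \<longrightarrow> ?f' b a = part s b)) \<longleftrightarrow> free_between c a" for c a
    unfolding free_between_def middle_descendant_card_inv[OF assms(1)]
      middle_descendant_card_inv[OF assms(3)] by blast
  have "compatible_variation s T A T' A' c a \<longleftrightarrow> compatible c a" for c a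
    unfolding compatible_variation_def compatible_variation_value_def vars free compatible_def both_def
    by metis
  then have A'': "A'' = {(a, c). minimal c a}"
    unfolding assms(7) minimal_compatible_def minimal_def by auto
  have asc: "A'' \<subseteq> tree_ascents s T''"
  proof -
    have "(c, a) \<in> node_pairs s" if "minimal c a" for a c
    proof (rule ccontr)
      assume "(c, a) \<notin> node_pairs s"
      then have "?h c a = 0" by (rule card_inv_outside)
      then show False using that by (simp add: minimal_def compatible_def both_def I1.varies_def)
    qed
    moreover have "(\<lambda>c a. card_inv s T'' c a) = fmax" by (simp add: T'' U(2))
    ultimately show ?thesis
      using minimal_ascent tree_ascents_card_inv[of T'' s] T'' U(1) by (auto simp: A'')
  qed
  let ?h'' = "card_inv s (tree_plus s T'' A'')"
  have T''_tree: "T'' \<in> s_trees s" and f'': "card_inv s T'' c a = fmax c a" for c a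
    using T'' U by simp_all
  note plus = tree_plus_card_inv[OF T''_tree asc]
  interpret I3: increment "part s" "card_inv s T''" ?h'' A'' by (rule plus(4))
  \<comment> \<open>At a minimal pair both intervals vary with the same value, so the added one
    still fits under \<open>h\<close> and \<open>h'\<close>.\<close>
  have count_le: "count (tree_inv s T'' + mset_set (A''\<inverse>)) (c, a) \<le> min (?h c a) (?h' c a)"
    if "a < c" for a c
  proof (cases "minimal c a")
    case True
    then have "both c a" by (simp add: minimal_def compatible_def)
    then show ?thesis
      unfolding plus(3) using fmax_both[OF \<open>both c a\<close>] True
      by (auto simp: f'' A'' both_def I1.varies_def I2.varies_def)
  next
    case False
    then show ?thesis
      unfolding plus(3)
      using I1.f_le_h[OF that] I2.f_le_h[OF that] f_le_h'[OF that] f'_le_h[OF that]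
      by (simp add: f'' A'')
  qed
  \<comment> \<open>\<open>h\<close> and \<open>h'\<close> are transitive and dominate the
    multi-set, hence also its closure.\<close>
  have le: "?h'' c a \<le> ?h c a" "?h'' c a \<le> ?h' c a" for c a
    unfolding plus(2)
  proof -
    note le = count_le[THEN min.boundedE]
    show "tc_mult (tree_inv s T'' + mset_set (A''\<inverse>)) c a \<le> ?h c a"
      by (rule tc_mult_le[OF tree_like_trans[OF I1.h]]) (assumption+, erule le)
    show "tc_mult (tree_inv s T'' + mset_set (A''\<inverse>)) c a \<le> ?h' c a"
      by (rule tc_mult_le[OF tree_like_trans[OF I2.h]]) (assumption+, erule le)
  qed
  \<comment> \<open>Conversely, \<open>meet_le\<close> with the multiplicities of
    \<open>T'' + A''\<close> in the role of \<open>g\<close>.\<close>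
  have ge: "min (?h c a) (?h' c a) \<le> ?h'' c a" if "a < c" for c a
  proof (rule meet_le[OF tree_like_trans[OF I3.h] _ _ that])
    show "fmax c a \<le> ?h'' c a" if "a < c" for a c using I3.f_le_h[OF that] unfolding f'' .
    show "fmax c a < ?h'' c a" if "minimal c a" for a c using I3.step[of a c] that by (simp add: A'' f'')
  qed
  have "R \<in> pure_interval s T A \<and> R \<in> pure_interval s T' A' \<longleftrightarrow> R \<in> pure_interval s T'' A''" for R
  proof -
    let ?r = "card_inv s R"
    have "(?f c a \<le> ?r c a \<and> ?r c a \<le> ?h c a) \<and> (?f' c a \<le> ?r c a \<and> ?r c a \<le> ?h' c a) \<longleftrightarrow>
        card_inv s T'' c a \<le> ?r c a \<and> ?r c a \<le> ?h'' c a" if "a < c" for a c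
      using le[of c a] ge[OF that] unfolding f'' by linarith
    then have "(\<forall>c a. a < c \<longrightarrow> (?f c a \<le> ?r c a \<and> ?r c a \<le> ?h c a) \<and> (?f' c a \<le> ?r c a \<and> ?r c a \<le> ?h' c a)) \<longleftrightarrow>
        (\<forall>c a. a < c \<longrightarrow> card_inv s T'' c a \<le> ?r c a \<and> ?r c a \<le> ?h'' c a)"
      by (intro all_cong1 imp_cong refl)
    then show ?thesis unfolding pure_interval_iff by metis
  qed
  then have "pure_interval s T A \<inter> pure_interval s T' A' = pure_interval s T'' A''" by blast
  then show ?thesis using T''_tree asc by blast
qed

end
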